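(* Let $T_1,\dots,T_n\in B(\mathcal H)$ ($n\in\mathbb N$ or $n=\infty$) be such that $\varphi_T(X):=\sum_{i=1}^nT_iXT_i^*$ is a $w^*$-continuous completely positive linear map with $\varphi_T(I)\le I$, and let $[V_1,\dots,V_n]$ on $\mathcal K\supseteq\mathcal H$ be the minimal isometric dilation of $[T_1,\dots,T_n]$, with $\varphi_V(Y):=\sum_{i=1}^nV_iYV_i^*$, $Y\in B(\mathcal K)$. Then: (i) A positive operator $C\in B(\mathcal H)$ satisfies $\varphi_T(C)\le C$ (resp. $\varphi_T(C)=C$) if and only if $C=P_{\mathcal H}D|_{\mathcal H}$ for some positive $D\in B(\mathcal K)$ with $\varphi_V(D)\le D$ (resp. $\varphi_V(D)=D$) and $\|C\|=\|D\|$. (ii) An operator $C\in B(\mathcal H)$ is a pure solution of $\varphi_T(X)\le X$ if and only if $C=P_{\mathcal H}D|_{\mathcal H}$ for some pure solution $D\in B(\mathcal K)$ of $\varphi_V(Y)\le Y$ with $\|C\|=\|D\|$.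
   Context: The minimal isometric dilation of a row contraction $[T_1,\dots,T_n]$ (i.e. $\sum T_iT_i^*\le I$) is an $n$-tuple of isometries $V_i$ with orthogonal ranges on a Hilbert space $\mathcal K\supseteq\mathcal H$ such that $V_i^*|_{\mathcal H}=T_i^*$ for all $i$ and $\mathcal K=\bigvee_{\alpha\in\mathbb F_n^+}V_\alpha\mathcal H$ (here $V_\alpha=V_{i_1}\cdots V_{i_k}$ for $\alpha=g_{i_1}\cdots g_{i_k}$, $V_{g_0}=I$). $P_{\mathcal H}$ is the orthogonal projection of $\mathcal K$ onto $\mathcal H$. A pure solution of $\psi(X)\le X$ is a $C\ge0$ with $\psi(C)\le C$ and $\psi^k(C)\to0$ strongly. *)

theory Defs
  imports "HOL-Analysis.Analysis" "HOL-Library.Extended_Nat"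
begin

text \<open>A complex Hilbert space, presented as a real Hilbert space together with
an orthogonal complex structure (multiplication by the imaginary unit).\<close>
class complex_hilbert = real_inner + complete_space +
  fixes iscale :: "'a \<Rightarrow> 'a"
  assumes iscale_add: "iscale (x + y) = iscale x + iscale y"
    and iscale_scaleR: "iscale (r *\<^sub>R x) = r *\<^sub>R iscale x"
    and iscale_iscale: "iscale (iscale x) = - x"
    and inner_iscale: "inner (iscale x) (iscale y) = inner x y"

text \<open>Complex scalar multiplication and the complex inner product
(linear in the first argument).\<close>
definition scaleC :: "complex \<Rightarrow> 'a::complex_hilbert \<Rightarrow> 'a" where
  "scaleC c x = Re c *\<^sub>R x + Im c *\<^sub>R iscale x"

definition cinner :: "'a::complex_hilbert \<Rightarrow> 'a \<Rightarrow> complex" where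
  "cinner x y = Complex (inner x y) (inner x (iscale y))"

definition bop :: "('a::complex_hilbert \<Rightarrow> 'b::complex_hilbert) \<Rightarrow> bool" where
  "bop A \<longleftrightarrow> bounded_linear A \<and> (\<forall>x. A (iscale x) = iscale (A x))"

definition cadj :: "('a::complex_hilbert \<Rightarrow> 'b::complex_hilbert) \<Rightarrow> 'b \<Rightarrow> 'a" where
  "cadj A = (THE B. \<forall>x y. cinner (A x) y = cinner x (B y))"

definition pos_op :: "('a::complex_hilbert \<Rightarrow> 'a) \<Rightarrow> bool" where
  "pos_op C \<longleftrightarrow> bop C \<and> (\<forall>x. Im (cinner (C x) x) = 0 \<and> 0 \<le> Re (cinner (C x) x))"

definition op_le :: "('a::complex_hilbert \<Rightarrow> 'a) \<Rightarrow> ('a \<Rightarrow> 'a) \<Rightarrow> bool" where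
  "op_le A B \<longleftrightarrow> pos_op (\<lambda>x. B x - A x)"

text \<open>Index set {1..n} (n finite) or all of N (n = infinity), shifted to start at 0.\<close>
definition idx :: "enat \<Rightarrow> nat set" where
  "idx n = {i. enat i < n}"

text \<open>phi_T(X) = sum_i T_i X T_i^*, the (possibly infinite) sum taken in the
strong operator topology (unconditional summation of vectors).\<close>
definition phi :: "enat \<Rightarrow> (nat \<Rightarrow> 'a::complex_hilbert \<Rightarrow> 'a) \<Rightarrow> ('a \<Rightarrow> 'a) \<Rightarrow> 'a \<Rightarrow> 'a" where
  "phi n T X = (\<lambda>h. infsum (\<lambda>i. T i (X (cadj (T i) h))) (idx n))"

fun vword :: "(nat \<Rightarrow> 'a \<Rightarrow> 'a) \<Rightarrow> nat list \<Rightarrow> 'a \<Rightarrow> 'a" where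
  "vword V [] = id"
| "vword V (i # \<alpha>) = V i \<circ> vword V \<alpha>"

text \<open>Minimal isometric dilation, with H embedded in K via the isometry W.\<close>
definition min_iso_dilation ::
  "enat \<Rightarrow> (nat \<Rightarrow> 'h::complex_hilbert \<Rightarrow> 'h) \<Rightarrow> ('h \<Rightarrow> 'k::complex_hilbert) \<Rightarrow> (nat \<Rightarrow> 'k \<Rightarrow> 'k) \<Rightarrow> bool" where
  "min_iso_dilation n T W V \<longleftrightarrow>
     bop W \<and> (\<forall>h. norm (W h) = norm h) \<and>
     (\<forall>i\<in>idx n. bop (V i) \<and> (\<forall>x. norm (V i x) = norm x)) \<and>
     (\<forall>i\<in>idx n. \<forall>j\<in>idx n. i \<noteq> j \<longrightarrow> (\<forall>x y. cinner (V i x) (V j y) = 0)) \<and>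
     (\<forall>i\<in>idx n. \<forall>h. cadj (V i) (W h) = W (cadj (T i) h)) \<and>
     closure (span {vword V \<alpha> (W h) | \<alpha> h. set \<alpha> \<subseteq> idx n}) = UNIV"

definition pure_solution :: "(('a::complex_hilbert \<Rightarrow> 'a) \<Rightarrow> ('a \<Rightarrow> 'a)) \<Rightarrow> ('a \<Rightarrow> 'a) \<Rightarrow> bool" where
  "pure_solution \<psi> C \<longleftrightarrow> pos_op C \<and> op_le (\<psi> C) C \<and>
     (\<forall>h. (\<lambda>k. (\<psi> ^^ k) C h) \<longlonglongrightarrow> 0)"

end

theory Submission
  imports Defs
begin

text \<open>Compression always works downwards, because \<open>V i\<^sup>* W = W T i\<^sup>*\<close> gives
  \<open>phi T (W\<^sup>* D W) = W\<^sup>* (phi V D) W\<close>. For the converse let \<open>level m\<close> be the vectors which every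
  \<open>V \<alpha>\<^sup>*\<close> with \<open>\<bar>\<alpha>\<bar> = m\<close> maps into the range of \<open>W\<close>. As quadratic form on \<open>level (m + 1)\<close>,
  \<open>phi V D\<close> depends only on the form of \<open>D\<close> on \<open>level m\<close>. So a lift known on \<open>level m\<close> is extended to
  \<open>level (m + 1)\<close> by choosing an operator between \<open>phi V D\<close> and the scalar \<open>\<parallel>C\<parallel>\<close> with prescribed form
  on \<open>level m\<close>; this is a Douglas factorization through the square root of \<open>\<parallel>C\<parallel> - phi V D\<close>. The limit
  is a subinvariant lift \<open>D\<close> of norm \<open>\<parallel>C\<parallel>\<close>. With \<open>F = lim phi V\<^sup>k D\<close>, the operator \<open>F\<close> lifts \<open>C\<close> in the
  invariant case, and \<open>D - F\<close> lifts \<open>C\<close> in the pure case.\<close>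

section \<open>Bounded and positive operators\<close>

text \<open>The norm condition shapes the induction. \<open>phi n V D\<close> lifts
  \<open>phi n T C\<close> and not \<open>C\<close>, so it must be enlarged, and an enlargement
  chosen only to restore the form on \<open>level m\<close> could exceed \<open>onorm C\<close>;
  hence this ceiling is part of every step. It lies above \<open>phi n V D\<close> because the
  orthogonality of the ranges makes \<open>phi n V\<close> preserve upper bounds by nonnegative
  scalars. The enlarged \<open>D'\<close> dominates \<open>phi n V D\<close> everywhere, and
  \<open>phi n V D'\<close> has the same form as \<open>phi n V D\<close> one level higher: this is
  how subinvariance climbs. Only the forms on the levels are tracked, where they stabilize;
  minimality makes the union of the levels dense, and so turns the stable form into an operator.
  Compression commutes with the powers of \<open>phi\<close> and with strong limits, so the
  compression of \<open>F\<close> is the limit of the iterates of \<open>phi n T\<close> on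
  \<open>C\<close>: it is \<open>C\<close> in the invariant case and 0 in the pure case. Since
  \<open>F\<close> lies between 0 and \<open>D\<close>, both \<open>F\<close> and
  \<open>D - F\<close> stay below the ceiling.\<close>

instance complex_hilbert \<subseteq> banach ..

lemma iscale_zero [simp]: "iscale 0 = (0::'a::complex_hilbert)"
  using iscale_scaleR[of 0 "0::'a"] by simp

lemma iscale_minus: "iscale (- x) = - iscale (x::'a::complex_hilbert)"
  using iscale_scaleR[of "-1" x] by simp

lemma iscale_diff: "iscale (x - y) = iscale x - iscale (y::'a::complex_hilbert)"
  using iscale_add[of x "- y"] by (simp add: iscale_minus)

lemma norm_iscale [simp]: "norm (iscale (x::'a::complex_hilbert)) = norm x"
  by (simp add: norm_eq_sqrt_inner inner_iscale)

lemma inner_iscale_left: "iscale x \<bullet> (y::'a::complex_hilbert) = - (x \<bullet> iscale y)"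
  using inner_iscale[of x "iscale y"] by (simp add: iscale_iscale)

lemma bounded_linear_iscale: "bounded_linear (iscale :: 'a::complex_hilbert \<Rightarrow> 'a)"
  by (rule bounded_linear_intro[where K=1]) (auto simp: iscale_add iscale_scaleR)

lemma bopD: "bop A \<Longrightarrow> bounded_linear A" "bop A \<Longrightarrow> A (iscale x) = iscale (A x)"
  by (auto simp: bop_def)

lemma bop_id: "bop (\<lambda>x. x)"
  unfolding bop_def by auto

lemma bop_zero: "bop (\<lambda>x. 0)"
  unfolding bop_def by auto

lemma bop_compose: "bop A \<Longrightarrow> bop B \<Longrightarrow> bop (\<lambda>x. A (B x))"
  unfolding bop_def by (auto intro: bounded_linear_compose)

lemma bop_add: "bop A \<Longrightarrow> bop B \<Longrightarrow> bop (\<lambda>x. A x + B x)"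
  unfolding bop_def by (auto intro: bounded_linear_add simp: iscale_add)

lemma bop_diff: "bop A \<Longrightarrow> bop B \<Longrightarrow> bop (\<lambda>x. A x - B x)"
  unfolding bop_def by (auto intro: bounded_linear_sub simp: iscale_diff)

lemma bop_scaleR: "bop A \<Longrightarrow> bop (\<lambda>x. r *\<^sub>R A x)"
  unfolding bop_def by (auto intro: bounded_linear_scaleR_right bounded_linear_compose[OF bounded_linear_scaleR_right] simp: iscale_scaleR)

lemmas bop_simps = bopD(2) linear_add[OF bounded_linear.linear[OF bopD(1)]]
  linear_diff[OF bounded_linear.linear[OF bopD(1)]]
  linear_scale[OF bounded_linear.linear[OF bopD(1)]]
  linear_0[OF bounded_linear.linear[OF bopD(1)]]

lemma bop_tendsto:
  assumes "bop A" "(f \<longlongrightarrow> l) F"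
  shows "((\<lambda>x. A (f x)) \<longlongrightarrow> A l) F"
  using bounded_linear.tendsto[OF bopD(1)] assms by blast

text \<open>Realness of the complex form says that \<open>C x \<bullet> iscale x = 0\<close>, and
  polarizing this at \<open>x + z\<close> with \<open>y = iscale z\<close> gives symmetry for the
  real inner product. Positivity can thus be handled through real quadratic forms.\<close>

lemma pos_op_iff:
  "pos_op C \<longleftrightarrow> bop C \<and> (\<forall>x y. C x \<bullet> y = x \<bullet> C y) \<and> (\<forall>x. 0 \<le> C x \<bullet> x)"
proof (cases "bop C")
  case True
  have "(\<forall>x. C x \<bullet> iscale x = 0) \<longleftrightarrow> (\<forall>x y. C x \<bullet> y = x \<bullet> C y)"
  proof safe
    fix x y :: 'a assume *: "\<forall>x. C x \<bullet> iscale x = 0"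
    define z where "z = - iscale y"
    have y: "y = iscale z" by (simp add: z_def iscale_minus iscale_iscale)
    have "C (x + z) \<bullet> iscale (x + z) = 0" using * by blast
    then have "C x \<bullet> iscale z + C z \<bullet> iscale x = 0"
      using *[rule_format, of x] *[rule_format, of z]
      by (simp add: bop_simps[OF True] iscale_add inner_add_left inner_add_right)
    moreover have "C z \<bullet> iscale x = - (C (iscale z) \<bullet> x)"
      by (simp add: bop_simps[OF True] inner_iscale_left)
    ultimately show "C x \<bullet> y = x \<bullet> C y" unfolding y inner_commute[of x "C (iscale z)"] by linarith
  next
    fix x assume *: "\<forall>x y. C x \<bullet> y = x \<bullet> C y"
    have "C x \<bullet> iscale x = x \<bullet> iscale (C x)" unfolding *[rule_format, of x "iscale x"] bopD(2)[OF True] ..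
    also have "\<dots> = - (iscale x \<bullet> C x)" by (simp add: inner_iscale_left)
    finally show "C x \<bullet> iscale x = 0" unfolding inner_commute[of "iscale x"] by linarith
  qed
  moreover have "pos_op C \<longleftrightarrow> (\<forall>x. C x \<bullet> iscale x = 0) \<and> (\<forall>x. 0 \<le> C x \<bullet> x)"
    using True unfolding pos_op_def cinner_def by (simp add: all_conj_distrib)
  ultimately show ?thesis using True by argo
qed (simp add: pos_op_def)

lemma pos_opD:
  assumes "pos_op C"
  shows "bop C" "C x \<bullet> y = x \<bullet> C y" "0 \<le> C x \<bullet> x"
  using assms by (auto simp: pos_op_iff)

lemma pos_op_add: "pos_op A \<Longrightarrow> pos_op B \<Longrightarrow> pos_op (\<lambda>x. A x + B x)"
  by (auto simp: pos_op_iff bop_add inner_add_left inner_add_right)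

lemma pos_op_diff:
  assumes A: "pos_op A" and B: "pos_op B" and le: "\<And>x. B x \<bullet> x \<le> A x \<bullet> x"
  shows "pos_op (\<lambda>x. A x - B x)"
  unfolding pos_op_iff
proof (intro conjI allI)
  show "bop (\<lambda>x. A x - B x)" by (intro bop_diff pos_opD(1) A B)
  show "(A x - B x) \<bullet> y = x \<bullet> (A y - B y)" for x y
    by (simp only: inner_diff_left inner_diff_right pos_opD(2)[OF A, of x y] pos_opD(2)[OF B, of x y])
  show "0 \<le> (A x - B x) \<bullet> x" for x using le by (simp add: inner_diff_left)
qed

lemma pos_op_scaleR: "pos_op A \<Longrightarrow> 0 \<le> r \<Longrightarrow> pos_op (\<lambda>x. r *\<^sub>R A x)"
  by (auto simp: pos_op_iff bop_scaleR)

lemma pos_op_id: "pos_op (\<lambda>x. x)"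
  by (auto simp: pos_op_iff bop_id)

lemma pos_op_zero: "pos_op (\<lambda>x. 0)"
  by (auto simp: pos_op_iff bop_zero)

lemma op_le_iff:
  assumes "pos_op A" "pos_op B"
  shows "op_le A B \<longleftrightarrow> (\<forall>x. A x \<bullet> x \<le> B x \<bullet> x)"
proof
  assume "op_le A B"
  then show "\<forall>x. A x \<bullet> x \<le> B x \<bullet> x"
    unfolding op_le_def using pos_opD(3)[of "\<lambda>x. B x - A x"] by (simp add: inner_diff_left)
qed (auto simp: op_le_def intro: pos_op_diff assms)

section \<open>Cauchy-Schwarz for positive forms and the norm bounds it yields\<close>

text \<open>The discriminant argument, carried out on a subspace because the form extended by
  \<open>pos_op_form_extension\<close> is controlled only there.\<close>

lemma form_Cauchy_Schwarz:
  fixes Q :: "'a::real_vector \<Rightarrow> 'a \<Rightarrow> real"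
  assumes S: "subspace S" "x \<in> S" "y \<in> S"
    and add: "\<And>x y z. x \<in> S \<Longrightarrow> y \<in> S \<Longrightarrow> z \<in> S \<Longrightarrow> Q (x + y) z = Q x z + Q y z"
    and scale: "\<And>r x z. x \<in> S \<Longrightarrow> z \<in> S \<Longrightarrow> Q (r *\<^sub>R x) z = r * Q x z"
    and sym: "\<And>x z. x \<in> S \<Longrightarrow> z \<in> S \<Longrightarrow> Q x z = Q z x"
    and pos: "\<And>x. x \<in> S \<Longrightarrow> 0 \<le> Q x x"
  shows "(Q x y)\<^sup>2 \<le> Q x x * Q y y"
proof -
  have expand: "Q (x + t *\<^sub>R y) (x + t *\<^sub>R y) = Q x x + 2 * t * Q x y + t\<^sup>2 * Q y y" for t
  proof -
    have m: "t *\<^sub>R y \<in> S" "x + t *\<^sub>R y \<in> S" using S by (auto intro: subspace_add subspace_scale)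
    have "Q (x + t *\<^sub>R y) u = Q x u + t * Q y u" if "u \<in> S" for u
      using add[OF S(2) m(1) that] scale[OF S(3) that] by simp
    note e = this[OF m(2)] this[OF S(2)] this[OF S(3)]
    show ?thesis
      unfolding e(1) sym[OF S(2) m(2)] sym[OF S(3) m(2)] e(2,3) sym[OF S(3) S(2)]
      by (simp add: algebra_simps power2_eq_square)
  qed
  have ge: "0 \<le> Q x x + 2 * t * Q x y + t\<^sup>2 * Q y y" for t
    unfolding expand[symmetric] using S by (intro pos) (auto intro: subspace_add subspace_scale)
  show ?thesis
  proof (cases "Q y y = 0")
    case True
    have "Q x y = 0"
    proof (rule ccontr)
      assume "Q x y \<noteq> 0"
      \<comment> \<open>For \<open>Q y y = 0\<close> the quadratic in \<open>t\<close> is affine,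
        and this \<open>t\<close> gives it the value -1.\<close>
      then show False using ge[of "- (Q x x + 1) / (2 * Q x y)"] True by (simp add: field_simps)
    qed
    then show ?thesis by (simp add: True)
  next
    case False
    then have p: "Q y y > 0" using pos[OF S(3)] by simp
    have "0 \<le> Q x x - (Q x y)\<^sup>2 / Q y y"
      using ge[of "- Q x y / Q y y"] p by (simp add: field_simps power2_eq_square)
    then show ?thesis using p by (simp add: field_simps)
  qed
qed

lemma pos_op_Cauchy_Schwarz:
  assumes "pos_op C" shows "(C x \<bullet> y)\<^sup>2 \<le> (C x \<bullet> x) * (C y \<bullet> y)"
  using pos_opD[OF assms]
  by (intro form_Cauchy_Schwarz[of UNIV])
    (auto simp: bop_simps(2,4) inner_add_left inner_add_right inner_commute)

text \<open>Cauchy-Schwarz for the form of \<open>C\<close> at the pair \<open>x\<close>,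
  \<open>C x\<close>, after which one factor \<open>(norm (C x))\<^sup>2\<close> cancels. This is
  what converts convergence of quadratic forms into convergence in norm.\<close>

lemma pos_op_norm_sq_le:
  assumes C: "pos_op C" and le: "\<And>x. C x \<bullet> x \<le> c * (norm x)\<^sup>2"
  shows "(norm (C x))\<^sup>2 \<le> c * (C x \<bullet> x)"
proof (cases "C x = 0")
  case False
  have "((norm (C x))\<^sup>2)\<^sup>2 = (C x \<bullet> C x)\<^sup>2" by (simp add: power2_norm_eq_inner)
  also have "\<dots> \<le> (C x \<bullet> x) * (C (C x) \<bullet> C x)" by (rule pos_op_Cauchy_Schwarz[OF C])
  also have "\<dots> \<le> (C x \<bullet> x) * (c * (norm (C x))\<^sup>2)"
    by (intro mult_left_mono le pos_opD(3)[OF C])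
  finally have "(norm (C x))\<^sup>2 * (norm (C x))\<^sup>2 \<le> (c * (C x \<bullet> x)) * (norm (C x))\<^sup>2"
    by (simp only: power2_eq_square mult_ac)
  then show ?thesis using False by (subst (asm) mult_le_cancel_right) auto
next
  case True then show ?thesis by simp
qed

lemma pos_op_norm_le:
  assumes C: "pos_op C" and c: "0 \<le> c" and le: "\<And>x. C x \<bullet> x \<le> c * (norm x)\<^sup>2"
  shows "norm (C x) \<le> c * norm x"
proof -
  have "(norm (C x))\<^sup>2 \<le> c * (C x \<bullet> x)" by (rule pos_op_norm_sq_le[OF C le])
  also have "\<dots> \<le> c * (c * (norm x)\<^sup>2)" by (intro mult_left_mono le c)
  also have "\<dots> = (c * norm x)\<^sup>2" by (simp add: power2_eq_square)
  finally show ?thesis using c by (simp add: power2_le_iff_abs_le)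
qed

lemma inner_le_onorm:
  assumes "bop C" shows "C x \<bullet> x \<le> onorm C * (norm x)\<^sup>2"
proof -
  have "C x \<bullet> x \<le> norm (C x) * norm x" by (rule norm_cauchy_schwarz)
  also have "\<dots> \<le> onorm C * norm x * norm x"
    by (intro mult_right_mono onorm[OF bopD(1)[OF assms]]) auto
  finally show ?thesis by (simp add: power2_eq_square)
qed

section \<open>Riesz representation and adjoints\<close>

text \<open>The functional is represented by the limit of a minimizing sequence of
  \<open>\<parallel>J s\<parallel>\<^sup>2 - 2 f s\<close>.\<close>
lemma Riesz_factor:
  fixes J :: "'a::real_vector \<Rightarrow> 'b::{real_inner,complete_space}"
  assumes S: "subspace S" and J: "linear J"
    and add: "\<And>x y. x \<in> S \<Longrightarrow> y \<in> S \<Longrightarrow> f (x + y) = f x + f y"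
    and scale: "\<And>r x. x \<in> S \<Longrightarrow> f (r *\<^sub>R x) = r * f x"
    and bd: "\<And>x. x \<in> S \<Longrightarrow> \<bar>f x\<bar> \<le> c * norm (J x)"
  shows "\<exists>z \<in> closure (J ` S). \<forall>x\<in>S. f x = J x \<bullet> z"
proof -
  define q where "q s = (norm (J s))\<^sup>2 - 2 * f s" for s
  have lower: "- c\<^sup>2 \<le> q s" if "s \<in> S" for s
  proof -
    have "0 \<le> (norm (J s) - c)\<^sup>2" by simp
    then show ?thesis using bd[OF that] by (simp add: q_def power2_eq_square algebra_simps)
  qed
  define m where "m = (INF s\<in>S. q s)"
  have bdd: "bdd_below (q ` S)" using lower by (auto simp: bdd_below_def)
  have ne: "S \<noteq> {}" using subspace_0[OF S] by auto
  have m_le: "m \<le> q s" if "s \<in> S" for s unfolding m_def by (rule cINF_lower[OF bdd that])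
  have "\<exists>s\<in>S. q s < m + 1 / real (Suc k)" for k
    using cInf_lessD[of "q ` S" "m + 1 / real (Suc k)"] ne unfolding m_def by auto
  then obtain s where s: "\<And>k. s k \<in> S" "\<And>k. q (s k) < m + 1 / real (Suc k)" by metis
  have J_add: "J (x + y) = J x + J y" and J_scale: "J (r *\<^sub>R x) = r *\<^sub>R J x" for x y r
    using J by (auto simp: linear_add linear_scale)
  \<comment> \<open>Parallelogram law: the linear part \<open>f\<close> cancels, so two
    near-minimizers of \<open>q\<close> have nearby images under \<open>J\<close>. The vectors
    \<open>s k\<close> themselves are not controlled.\<close>
  have par: "(norm (J x - J y))\<^sup>2 = 2 * q x + 2 * q y - 4 * q ((1/2) *\<^sub>R (x + y))"
    if "x \<in> S" "y \<in> S" for x y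
  proof -
    have "f ((1/2) *\<^sub>R (x + y)) = (f x + f y) / 2"
      using that S by (simp add: add scale subspace_add del: scaleR_right_distrib)
    moreover have "J ((1/2) *\<^sub>R (x + y)) = (1/2) *\<^sub>R (J x + J y)" by (simp add: J_add J_scale)
    ultimately show ?thesis
      by (simp only: q_def power2_norm_eq_inner)
        (simp add: inner_add_left inner_add_right inner_diff_left inner_diff_right inner_commute field_simps)
  qed
  have dist: "(norm (J (s k) - J (s l)))\<^sup>2 < 2 / real (Suc k) + 2 / real (Suc l)" for k l
  proof -
    have "m \<le> q ((1/2) *\<^sub>R (s k + s l))" using S s by (intro m_le subspace_scale subspace_add) auto
    then show ?thesis using par[OF s(1)[of k] s(1)[of l]] s(2)[of k] s(2)[of l] by simp
  qed
  have "Cauchy (\<lambda>k. J (s k))"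
  proof (rule metric_CauchyI)
    fix e :: real assume e: "0 < e"
    obtain N :: nat where N: "4 / e\<^sup>2 < real N" using reals_Archimedean2 by blast
    then have N0: "0 < real N" using e by (smt (verit) divide_pos_pos zero_less_power)
    have N': "4 / real N < e\<^sup>2" using N N0 e by (simp add: field_simps)
    have "dist (J (s k)) (J (s l)) < e" if "k \<ge> N" "l \<ge> N" for k l
    proof -
      have "1 / real (Suc k) \<le> 1 / real N" "1 / real (Suc l) \<le> 1 / real N"
        using that N0 by (auto intro!: divide_left_mono)
      then have "(norm (J (s k) - J (s l)))\<^sup>2 < e\<^sup>2" using dist[of k l] N' by simp
      then show ?thesis using e by (simp add: dist_norm power2_less_imp_less)
    qed
    then show "\<exists>M. \<forall>k\<ge>M. \<forall>l\<ge>M. dist (J (s k)) (J (s l)) < e" by blast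
  qed
  then obtain z where z: "(\<lambda>k. J (s k)) \<longlonglongrightarrow> z" using Cauchy_convergent convergent_def by blast
  have "z \<in> closure (J ` S)"
    using z s(1) by (auto simp: closure_sequential intro!: exI[of _ "\<lambda>k. J (s k)"])
  moreover have "f x = J x \<bullet> z" if x: "x \<in> S" for x
  proof -
    define d where "d = J x \<bullet> z - f x"
    \<comment> \<open>Minimality of \<open>m\<close> tested at \<open>s k + t *\<^sub>R x\<close>,
      in the limit in \<open>k\<close>. Its validity for every \<open>t\<close> forces the linear
      coefficient \<open>d\<close> to vanish.\<close>
    have ineq: "0 \<le> 2 * t * d + t\<^sup>2 * (norm (J x))\<^sup>2" for t
    proof -
      have "m \<le> (m + 1 / real (Suc k)) + 2 * t * (J x \<bullet> J (s k) - f x) + t\<^sup>2 * (norm (J x))\<^sup>2" for k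
      proof -
        have "m \<le> q (s k + t *\<^sub>R x)" using S s x by (intro m_le subspace_add subspace_scale) auto
        also have "\<dots> = q (s k) + 2 * t * (J x \<bullet> J (s k) - f x) + t\<^sup>2 * (norm (J x))\<^sup>2"
          using S s x unfolding q_def power2_norm_eq_inner
          by (simp add: add scale J_add J_scale subspace_scale inner_add_left inner_add_right
              inner_commute power2_eq_square algebra_simps)
        finally show ?thesis using s(2)[of k] by simp
      qed
      moreover have "(\<lambda>k. (m + 1 / real (Suc k)) + 2 * t * (J x \<bullet> J (s k) - f x) + t\<^sup>2 * (norm (J x))\<^sup>2)
          \<longlonglongrightarrow> (m + 0) + 2 * t * (J x \<bullet> z - f x) + t\<^sup>2 * (norm (J x))\<^sup>2"
        by (intro tendsto_intros z LIMSEQ_Suc[OF lim_1_over_n])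
      ultimately have "m \<le> (m + 0) + 2 * t * (J x \<bullet> z - f x) + t\<^sup>2 * (norm (J x))\<^sup>2"
        by (intro Lim_bounded2[of _ _ 0]) auto
      then show ?thesis by (simp add: d_def)
    qed
    have "d = 0"
    proof (cases "J x = 0")
      case True then show ?thesis using bd[OF x] by (simp add: d_def)
    next
      case False
      define t where "t = - d / (norm (J x))\<^sup>2"
      have "2 * t * d + t\<^sup>2 * (norm (J x))\<^sup>2 = - d\<^sup>2 / (norm (J x))\<^sup>2"
        using False by (simp add: t_def field_simps power2_eq_square)
      then have "d\<^sup>2 / (norm (J x))\<^sup>2 \<le> 0" using ineq[of t] by simp
      then show ?thesis using False by (simp add: divide_le_0_iff)
    qed
    then show ?thesis by (simp add: d_def)
  qed
  ultimately show ?thesis by blast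
qed

lemma closure_subspace:
  fixes S :: "'a::real_normed_vector set"
  assumes "subspace S" shows "subspace (closure S)"
  unfolding subspace_def
proof (intro conjI ballI allI)
  show "0 \<in> closure S" using subspace_0[OF assms] closure_subset by blast
  show "x + y \<in> closure S" if xy: "x \<in> closure S" "y \<in> closure S" for x y
  proof -
    obtain u v where "\<forall>k. u k \<in> S" "u \<longlonglongrightarrow> x" "\<forall>k. v k \<in> S" "v \<longlonglongrightarrow> y"
      using xy unfolding closure_sequential by blast
    then show ?thesis unfolding closure_sequential
      using assms by (intro exI[of _ "\<lambda>k. u k + v k"]) (auto intro: tendsto_add subspace_add)
  qed
  show "r *\<^sub>R x \<in> closure S" if x: "x \<in> closure S" for r x
  proof -
    obtain u where "\<forall>k. u k \<in> S" "u \<longlonglongrightarrow> x"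
      using x unfolding closure_sequential by blast
    then show ?thesis unfolding closure_sequential
      using assms by (intro exI[of _ "\<lambda>k. r *\<^sub>R u k"]) (auto intro: tendsto_scaleR subspace_scale)
  qed
qed

lemma closure_inner_eqI:
  fixes z w :: "'a::real_inner"
  assumes S: "subspace S" and z: "z \<in> closure S" "w \<in> closure S"
    and eq: "\<And>x. x \<in> S \<Longrightarrow> x \<bullet> z = x \<bullet> w"
  shows "z = w"
proof -
  have "closure S \<subseteq> {x. x \<bullet> (z - w) = 0}"
    by (rule closure_minimal) (auto simp: inner_diff_right eq intro!: closed_Collect_eq continuous_intros)
  moreover have "z - w \<in> closure S" using z S by (intro subspace_diff[OF closure_subspace])
  ultimately have "(z - w) \<bullet> (z - w) = 0" by blast
  then show ?thesis by simp
qed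

text \<open>By continuity the bound may be tested at \<open>x = z\<close>. The alternative
  \<open>z = 0\<close> accounts for a negative \<open>c\<close>.\<close>

lemma closure_inner_norm_le:
  fixes z :: "'a::real_inner"
  assumes z: "z \<in> closure S" and le: "\<And>x. x \<in> S \<Longrightarrow> x \<bullet> z \<le> c * norm x"
  shows "norm z \<le> c \<or> z = 0"
proof -
  have "closure S \<subseteq> {x. x \<bullet> z \<le> c * norm x}"
    by (rule closure_minimal) (auto simp: le intro!: closed_Collect_le continuous_intros)
  then have "z \<bullet> z \<le> c * norm z" using z by blast
  then have "norm z * norm z \<le> c * norm z" by (simp add: power2_norm_eq_inner[symmetric] power2_eq_square)
  then show ?thesis by (auto simp: mult_le_cancel_right)
qed

section \<open>Adjoints of complex-linear bounded operators\<close>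

lemma bop_adjoint_exists:
  fixes A :: "'a::complex_hilbert \<Rightarrow> 'b::complex_hilbert"
  assumes A: "bop A"
  shows "\<exists>B. bop B \<and> (\<forall>x y. A x \<bullet> y = x \<bullet> B y)"
proof -
  obtain c where c: "0 < c" "\<And>x. norm (A x) \<le> norm x * c"
    using bounded_linear.pos_bounded[OF bopD(1)[OF A]] by blast
  have bd: "\<bar>A x \<bullet> y\<bar> \<le> (c * norm y) * norm x" for x y
  proof -
    have "\<bar>A x \<bullet> y\<bar> \<le> norm (A x) * norm y" by (rule Cauchy_Schwarz_ineq2)
    also have "\<dots> \<le> (norm x * c) * norm y" by (intro mult_right_mono c) auto
    finally show ?thesis by (simp add: mult_ac)
  qed
  have "\<exists>z\<in>closure ((\<lambda>x. x) ` UNIV). \<forall>x\<in>UNIV. A x \<bullet> y = x \<bullet> z" for y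
    by (rule Riesz_factor[where J = "\<lambda>x. x"])
      (use bd in \<open>auto simp: bop_simps[OF A] inner_add_left linear_ident\<close>)
  then obtain B where B: "\<And>x y. A x \<bullet> y = x \<bullet> B y" by (metis UNIV_I)
  have eqI: "u = v" if "\<And>x. x \<bullet> u = x \<bullet> v" for u v :: 'a
    using that vector_eq_ldot by blast
  have "bounded_linear B"
  proof (rule bounded_linear_intro[where K = c])
    show "B (x + y) = B x + B y" for x y
      by (rule eqI) (simp add: inner_add_right flip: B)
    show "B (r *\<^sub>R x) = r *\<^sub>R B x" for r x
      by (rule eqI) (simp flip: B)
    show "norm (B y) \<le> norm y * c" for y
      using closure_inner_norm_le[of "B y" UNIV "c * norm y"] bd[of _ y] c(1)
      by (auto simp: mult_ac abs_le_iff simp flip: B)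
  qed
  moreover have "B (iscale x) = iscale (B x)" for x
  proof (rule eqI)
    fix y
    have "y \<bullet> B (iscale x) = - (iscale (A y) \<bullet> x)" by (simp add: inner_iscale_left flip: B)
    also have "\<dots> = - (A (iscale y) \<bullet> x)" by (simp add: bop_simps[OF A])
    also have "\<dots> = y \<bullet> iscale (B x)" by (simp add: B inner_iscale_left)
    finally show "y \<bullet> B (iscale x) = y \<bullet> iscale (B x)" .
  qed
  ultimately show ?thesis using B by (auto simp: bop_def)
qed

text \<open>The real adjoint commutes with \<open>iscale\<close>, so the imaginary part of the
  identity that defines \<open>cadj\<close> follows from the real one; the real part alone already
  gives uniqueness.\<close>

lemma
  fixes A :: "'a::complex_hilbert \<Rightarrow> 'b::complex_hilbert"
  assumes A: "bop A"
  shows bop_cadj: "bop (cadj A)" and inner_cadj: "A x \<bullet> y = x \<bullet> cadj A y"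
proof -
  obtain B where B: "bop B" "\<And>x y. A x \<bullet> y = x \<bullet> B y" using bop_adjoint_exists[OF A] by blast
  have "cadj A = B" unfolding cadj_def
  proof (rule the_equality)
    have "A x \<bullet> iscale y = x \<bullet> iscale (B y)" for x y
      by (simp add: B bop_simps[OF B(1)])
    then show "\<forall>x y. cinner (A x) y = cinner x (B y)" using B by (simp add: cinner_def)
  next
    fix B' assume "\<forall>x y. cinner (A x) y = cinner x (B' y)"
    then have "x \<bullet> B' y = x \<bullet> B y" for x y by (simp add: cinner_def B)
    then show "B' = B" using vector_eq_ldot by blast
  qed
  then show "bop (cadj A)" "A x \<bullet> y = x \<bullet> cadj A y" using B by auto
qed

lemma cadj_eqI:
  fixes A :: "'a::complex_hilbert \<Rightarrow> 'b::complex_hilbert"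
  assumes "bop A" "\<And>x. A x \<bullet> y = x \<bullet> z" shows "cadj A y = z"
  using assms vector_eq_ldot inner_cadj by metis

lemma isometry_inner:
  assumes "bop A" "\<And>x. norm (A x) = norm x" shows "A x \<bullet> A y = x \<bullet> y"
proof -
  have "norm (A x + A y) = norm (x + y)" using assms(2)[of "x + y"] by (simp add: bop_simps[OF assms(1)])
  then show ?thesis using assms(2)[of x] assms(2)[of y]
    by (smt (verit) dot_norm)
qed

lemma cadj_isometry:
  assumes "bop A" "\<And>x. norm (A x) = norm x" shows "cadj A (A x) = x"
  by (rule cadj_eqI[OF assms(1)]) (rule isometry_inner[OF assms])

lemma norm_cadj_isometry_le:
  assumes "bop A" "\<And>x. norm (A x) = norm x" shows "norm (cadj A x) \<le> norm x"
proof -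
  have "x \<bullet> A (cadj A x) = cadj A x \<bullet> cadj A x"
    by (metis inner_cadj[OF assms(1)] inner_commute)
  then have "(norm (cadj A x))\<^sup>2 \<le> norm x * norm (cadj A x)"
    using norm_cauchy_schwarz[of x "A (cadj A x)"] by (simp add: assms(2) power2_norm_eq_inner)
  then have "norm (cadj A x) * norm (cadj A x) \<le> norm x * norm (cadj A x)"
    by (simp add: power2_eq_square)
  then show ?thesis by (cases "cadj A x = 0") (auto simp: mult_le_cancel_right)
qed

lemma inner_cadj': "bop A \<Longrightarrow> cadj A x \<bullet> y = x \<bullet> A y"
  by (metis inner_cadj inner_commute)

lemma pos_op_compress:
  assumes D: "pos_op D" and W: "bop W" shows "pos_op (cadj W \<circ> D \<circ> W)"
  unfolding pos_op_iff
proof (intro conjI allI)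
  show "bop (cadj W \<circ> D \<circ> W)"
    unfolding comp_def
    by (rule bop_compose[OF bop_cadj[OF W] bop_compose[OF pos_opD(1)[OF D] W]])
  show "(cadj W \<circ> D \<circ> W) x \<bullet> y = x \<bullet> (cadj W \<circ> D \<circ> W) y" for x y
    by (simp add: inner_cadj'[OF W] pos_opD(2)[OF D, of "W x"] flip: inner_cadj[OF W])
  show "0 \<le> (cadj W \<circ> D \<circ> W) x \<bullet> x" for x
    by (simp add: inner_cadj'[OF W] pos_opD(3)[OF D])
qed

section \<open>Monotone limits and square roots\<close>

lemma bop_limit:
  fixes X :: "nat \<Rightarrow> 'a::complex_hilbert \<Rightarrow> 'b::complex_hilbert"
  assumes X: "\<And>k. bop (X k)" and lim: "\<And>x. (\<lambda>k. X k x) \<longlonglongrightarrow> Y x"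
    and bd: "\<And>k x. norm (X k x) \<le> c * norm x"
  shows "bop Y"
  unfolding bop_def
proof (intro conjI allI bounded_linear_intro[where K = c])
  show "Y (x + y) = Y x + Y y" for x y
    using tendsto_add[OF lim[of x] lim[of y]] lim[of "x + y"]
    by (simp add: bop_simps(2)[OF X] LIMSEQ_unique)
  show "Y (r *\<^sub>R x) = r *\<^sub>R Y x" for r x
    using tendsto_scaleR[OF tendsto_const lim[of x], of r] lim[of "r *\<^sub>R x"]
    by (simp add: bop_simps(4)[OF X] LIMSEQ_unique)
  show "norm (Y x) \<le> norm x * c" for x
    using bd[of _ x] by (intro Lim_bounded[OF tendsto_norm[OF lim[of x]], of 0]) (simp add: mult.commute)
  show "Y (iscale x) = iscale (Y x)" for x
    using bounded_linear.tendsto[OF bounded_linear_iscale lim[of x]] lim[of "iscale x"]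
    by (simp add: bop_simps(1)[OF X] LIMSEQ_unique)
qed

text \<open>For \<open>k \<le> l\<close> the difference \<open>X k - X l\<close> is positive and
  bounded by \<open>c\<close>, so \<open>pos_op_norm_sq_le\<close> bounds its squared norm at
  \<open>x\<close> by \<open>c\<close> times the decrease of the scalars
  \<open>X k x \<bullet> x\<close>, which converge.\<close>

lemma pos_op_decseq_limit:
  assumes pos: "\<And>k. pos_op (X k)" and dec: "\<And>k x. X (Suc k) x \<bullet> x \<le> X k x \<bullet> x"
  shows "\<exists>Y. pos_op Y \<and> (\<forall>x. (\<lambda>k. X k x) \<longlonglongrightarrow> Y x) \<and> (\<forall>k x. Y x \<bullet> x \<le> X k x \<bullet> x)"
proof -
  define c where "c = onorm (X 0)"
  have c0: "0 \<le> c" unfolding c_def by (intro onorm_pos_le bopD(1) pos_opD(1) pos)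
  have decs: "decseq (\<lambda>k. X k x \<bullet> x)" for x using dec by (intro decseq_SucI)
  have le_c: "X k x \<bullet> x \<le> c * (norm x)\<^sup>2" for k x
    using decseqD[OF decs, of 0 k x] inner_le_onorm[OF pos_opD(1)[OF pos[of 0]], of x]
    by (simp add: c_def)
  have diff: "(norm (X k x - X l x))\<^sup>2 \<le> c * (X k x \<bullet> x - X l x \<bullet> x)" if "k \<le> l" for k l x
  proof -
    have p: "pos_op (\<lambda>x. X k x - X l x)"
      by (rule pos_op_diff[OF pos pos decseqD[OF decs that]])
    show ?thesis
      using pos_op_norm_sq_le[OF p, of c x] le_c[of k] pos_opD(3)[OF pos[of l]]
      by (simp add: inner_diff_left) (smt (verit))
  qed
  have "Cauchy (\<lambda>k. X k x)" for x
  proof (rule metric_CauchyI)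
    fix e :: real assume e: "0 < e"
    have "convergent (\<lambda>k. X k x \<bullet> x)"
      by (rule decseq_convergent[OF decs[of x], of 0]) (auto simp: convergent_def pos_opD(3)[OF pos])
    then have "Cauchy (\<lambda>k. X k x \<bullet> x)" by (rule convergent_Cauchy)
    \<comment> \<open>The denominator is \<open>c + 1\<close> because the operator norm
      \<open>c\<close> may be 0.\<close>
    moreover have e': "0 < e\<^sup>2 / (c + 1)" using e c0 by simp
    ultimately obtain N where N: "\<And>k l. k \<ge> N \<Longrightarrow> l \<ge> N \<Longrightarrow> dist (X k x \<bullet> x) (X l x \<bullet> x) < e\<^sup>2 / (c + 1)"
      unfolding Cauchy_def by blast
    have main: "dist (X k x) (X l x) < e" if "N \<le> k" "k \<le> l" for k l
    proof -
      have nn: "0 \<le> X k x \<bullet> x - X l x \<bullet> x" using decseqD[OF decs that(2)] by simp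
      have "(norm (X k x - X l x))\<^sup>2 \<le> (c + 1) * (X k x \<bullet> x - X l x \<bullet> x)"
        using diff[OF that(2), of x] nn by (simp add: distrib_right)
      also have "\<dots> < (c + 1) * (e\<^sup>2 / (c + 1))"
        using N[of k l] that c0 by (intro mult_strict_left_mono) (auto simp: dist_real_def)
      also have "\<dots> = e\<^sup>2" using c0 by simp
      finally show ?thesis using e by (simp add: dist_norm power2_less_imp_less)
    qed
    then show "\<exists>M. \<forall>m\<ge>M. \<forall>n\<ge>M. dist (X m x) (X n x) < e"
      by (metis dist_commute nle_le)
  qed
  then have "\<forall>x. \<exists>l. (\<lambda>k. X k x) \<longlonglongrightarrow> l"
    using Cauchy_convergent unfolding convergent_def by blast
  then obtain Y where Y: "\<And>x. (\<lambda>k. X k x) \<longlonglongrightarrow> Y x"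
    using choice[of "\<lambda>x l. (\<lambda>k. X k x) \<longlonglongrightarrow> l"] by blast
  have "bop Y"
    by (rule bop_limit[OF pos_opD(1)[OF pos] Y pos_op_norm_le[OF pos c0 le_c]])
  moreover have "Y x \<bullet> y = x \<bullet> Y y" for x y
    using tendsto_inner[OF Y[of x] tendsto_const[of y]] tendsto_inner[OF tendsto_const[of x] Y[of y]]
    by (simp add: pos_opD(2)[OF pos] LIMSEQ_unique)
  moreover have "0 \<le> Y x \<bullet> x" for x
    using pos_opD(3)[OF pos]
    by (intro Lim_bounded2[OF tendsto_inner[OF Y[of x] tendsto_const[of x]], of 0]) auto
  moreover have "Y x \<bullet> x \<le> X k x \<bullet> x" for k x
    by (rule decseq_ge[OF decs tendsto_inner[OF Y tendsto_const]])
  ultimately show ?thesis using Y by (auto simp: pos_op_iff)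
qed

section \<open>Square roots of positive operators\<close>

text \<open>Polynomials in \<open>A\<close> with nonnegative coefficients. A product of positive
  operators need not be positive, but this class consists of commuting positive operators and is
  closed under composition; it stands in for a functional calculus.\<close>

inductive nonneg_poly :: "('a::complex_hilbert \<Rightarrow> 'a) \<Rightarrow> ('a \<Rightarrow> 'a) \<Rightarrow> bool" for A where
  nonneg_poly_zero: "nonneg_poly A (\<lambda>x. 0)"
| nonneg_poly_add_power:
    "nonneg_poly A X \<Longrightarrow> 0 \<le> r \<Longrightarrow> nonneg_poly A (\<lambda>x. X x + r *\<^sub>R (A ^^ j) x)"

text \<open>Induction in steps of two: \<open>A ^^ (n + 2)\<close> is \<open>A ^^ n\<close> with
  \<open>A\<close> on both sides, so its form at \<open>x\<close> is the form of
  \<open>A ^^ n\<close> at \<open>A x\<close>.\<close>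

lemma pos_op_funpow:
  assumes "pos_op A" shows "pos_op (A ^^ j)"
proof (induction j rule: induct_nat_012)
  case 0 then show ?case using pos_op_id by (simp add: id_def)
next
  case 1 then show ?case using assms by simp
next
  case (ge2 n)
  have e: "A ^^ Suc (Suc n) = (\<lambda>x. A ((A ^^ n) (A x)))" by (simp add: fun_eq_iff funpow_swap1)
  show ?case unfolding pos_op_iff e
  proof (intro conjI allI)
    show "bop (\<lambda>x. A ((A ^^ n) (A x)))"
      by (rule bop_compose[OF pos_opD(1)[OF assms] bop_compose[OF pos_opD(1)[OF ge2(1)] pos_opD(1)[OF assms]]])
    show "A ((A ^^ n) (A x)) \<bullet> y = x \<bullet> A ((A ^^ n) (A y))" for x y
      using pos_opD(2)[OF assms] pos_opD(2)[OF ge2(1)] by metis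
    show "0 \<le> A ((A ^^ n) (A x)) \<bullet> x" for x
      using pos_opD(2)[OF assms] pos_opD(3)[OF ge2(1)] by metis
  qed
qed

context
  fixes A :: "'a::complex_hilbert \<Rightarrow> 'a"
  assumes A: "pos_op A"
begin

lemma pos_op_nonneg_poly: "nonneg_poly A X \<Longrightarrow> pos_op X"
  by (induction rule: nonneg_poly.induct)
    (simp_all add: pos_op_zero pos_op_add pos_op_scaleR pos_op_funpow A)

lemma nonneg_poly_add: "nonneg_poly A Y \<Longrightarrow> nonneg_poly A X \<Longrightarrow> nonneg_poly A (\<lambda>x. X x + Y x)"
proof (induction rule: nonneg_poly.induct)
  case (nonneg_poly_add_power Y r j)
  have "nonneg_poly A (\<lambda>x. (X x + Y x) + r *\<^sub>R (A ^^ j) x)"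
    using nonneg_poly_add_power by (intro nonneg_poly.nonneg_poly_add_power) auto
  then show ?case by (simp add: add.assoc)
qed simp

lemma nonneg_poly_scaleR: "nonneg_poly A X \<Longrightarrow> 0 \<le> s \<Longrightarrow> nonneg_poly A (\<lambda>x. s *\<^sub>R X x)"
proof (induction rule: nonneg_poly.induct)
  case nonneg_poly_zero
  show ?case using nonneg_poly.nonneg_poly_zero by simp
next
  case (nonneg_poly_add_power Y r j)
  have "nonneg_poly A (\<lambda>x. s *\<^sub>R Y x + (s * r) *\<^sub>R (A ^^ j) x)"
    using nonneg_poly_add_power by (intro nonneg_poly.nonneg_poly_add_power) auto
  then show ?case by (simp add: scaleR_add_right)
qed

lemma nonneg_poly_power: "nonneg_poly A X \<Longrightarrow> nonneg_poly A (\<lambda>x. X ((A ^^ j) x))"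
proof (induction rule: nonneg_poly.induct)
  case (nonneg_poly_add_power Y r i)
  then have "nonneg_poly A (\<lambda>x. Y ((A ^^ j) x) + r *\<^sub>R (A ^^ (i + j)) x)"
    by (intro nonneg_poly.nonneg_poly_add_power) auto
  then show ?case by (simp add: funpow_add)
qed (rule nonneg_poly_zero)

lemma nonneg_poly_compose:
  "nonneg_poly A Y \<Longrightarrow> nonneg_poly A X \<Longrightarrow> nonneg_poly A (\<lambda>x. X (Y x))"
proof (induction rule: nonneg_poly.induct)
  case nonneg_poly_zero
  then show ?case
    using nonneg_poly.nonneg_poly_zero by (simp add: bop_simps(5)[OF pos_opD(1)[OF pos_op_nonneg_poly]])
next
  case (nonneg_poly_add_power Y r j)
  have "nonneg_poly A (\<lambda>x. X (Y x) + r *\<^sub>R X ((A ^^ j) x))"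
    using nonneg_poly_add_power by (intro nonneg_poly_add nonneg_poly_scaleR nonneg_poly_power) auto
  then show ?case
    using pos_opD(1)[OF pos_op_nonneg_poly[OF nonneg_poly_add_power(4)]]
    by (simp add: bop_simps(2,4))
qed

lemma nonneg_poly_commute_power:
  "nonneg_poly A X \<Longrightarrow> X ((A ^^ j) x) = (A ^^ j) (X x)"
proof (induction rule: nonneg_poly.induct)
  case nonneg_poly_zero
  show ?case by (simp add: bop_simps(5)[OF pos_opD(1)[OF pos_op_funpow[OF A]]])
next
  case (nonneg_poly_add_power X r i)
  have "(A ^^ i) ((A ^^ j) x) = (A ^^ j) ((A ^^ i) x)"
    by (metis add.commute comp_apply funpow_add)
  then show ?case using nonneg_poly_add_power
    by (simp add: bop_simps(2,4)[OF pos_opD(1)[OF pos_op_funpow[OF A]]])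
qed

lemma nonneg_poly_commute:
  "nonneg_poly A Y \<Longrightarrow> nonneg_poly A X \<Longrightarrow> X (Y x) = Y (X x)"
proof (induction rule: nonneg_poly.induct)
  case nonneg_poly_zero
  then show ?case by (simp add: bop_simps(5)[OF pos_opD(1)[OF pos_op_nonneg_poly]])
next
  case (nonneg_poly_add_power Y r j)
  then show ?case
    using pos_opD(1)[OF pos_op_nonneg_poly[OF nonneg_poly_add_power(4)]]
      nonneg_poly_commute_power[OF nonneg_poly_add_power(4)]
    by (simp add: bop_simps(2,4))
qed

end

text \<open>The iteration \<open>B \<mapsto> (A + B\<^sup>2)/2\<close> increases to \<open>1 - sqrt (1 - A)\<close>.\<close>
fun sqrt_iter :: "('a::complex_hilbert \<Rightarrow> 'a) \<Rightarrow> nat \<Rightarrow> 'a \<Rightarrow> 'a" where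
  "sqrt_iter A 0 = (\<lambda>x. 0)"
| "sqrt_iter A (Suc k) = (\<lambda>x. (1/2) *\<^sub>R (A x + sqrt_iter A k (sqrt_iter A k x)))"

text \<open>For consecutive iterates \<open>B\<close>, \<open>C\<close> with difference
  \<open>d\<close>, commutation gives \<open>C (C x) - B (B x) = C (d x) + B (d x)\<close>. The next
  increment is half of this, again a polynomial with nonnegative coefficients, whereas mere
  positivity of \<open>d\<close> would not carry through the product.\<close>

lemma sqrt_iter_props:
  assumes A: "pos_op A"
  shows "nonneg_poly A (sqrt_iter A k) \<and> nonneg_poly A (\<lambda>x. sqrt_iter A (Suc k) x - sqrt_iter A k x)"
proof (induction k)
  have A1: "nonneg_poly A A"
    using nonneg_poly_add_power[OF nonneg_poly_zero, of 1 A 1] by simp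
  {
    case 0
    show ?case using nonneg_poly_scaleR[OF A A1, of "1/2"] nonneg_poly_zero by simp
  next
    case (Suc k)
    let ?B = "sqrt_iter A k" and ?C = "sqrt_iter A (Suc k)"
    define d where "d = (\<lambda>x. ?C x - ?B x)"
    have B: "nonneg_poly A ?B" and d: "nonneg_poly A d" using Suc unfolding d_def by auto
    have "nonneg_poly A (\<lambda>x. ?B x + d x)" by (rule nonneg_poly_add[OF A d B])
    then have C: "nonneg_poly A ?C" by (simp add: d_def)
    have "nonneg_poly A (\<lambda>x. (1/2) *\<^sub>R (?C (d x) + ?B (d x)))"
      by (rule nonneg_poly_scaleR[OF A nonneg_poly_add[OF A
              nonneg_poly_compose[OF A d B] nonneg_poly_compose[OF A d C]]]) simp
    moreover have "(1/2) *\<^sub>R (?C (d x) + ?B (d x)) = sqrt_iter A (Suc (Suc k)) x - ?C x" for x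
    proof -
      have e: "?C (d x) + ?B (d x) = ?C (?C x) - ?B (?B x)"
        unfolding d_def
          bop_simps(3)[OF pos_opD(1)[OF pos_op_nonneg_poly[OF A C]]]
          bop_simps(3)[OF pos_opD(1)[OF pos_op_nonneg_poly[OF A B]]]
        using nonneg_poly_commute[OF A B C, of x] by simp
      have "sqrt_iter A (Suc (Suc k)) x - ?C x
          = (1/2) *\<^sub>R (A x + ?C (?C x)) - (1/2) *\<^sub>R (A x + ?B (?B x))" by simp
      then show ?thesis unfolding e by (simp only: scaleR_diff_right[symmetric] add_diff_cancel_left)
    qed
    ultimately show ?case using C by simp
  }
qed

text \<open>The iterates are increasing contractions, so \<open>1 - sqrt_iter A k\<close> decreases
  to some positive \<open>J\<close>. For \<open>L = 1 - J\<close> the recursion becomes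
  \<open>2 L = A + L L\<close> in the limit, which says \<open>J J = 1 - A\<close>.\<close>

lemma pos_op_sqrt_contraction:
  assumes A: "pos_op A" and le: "\<And>x. A x \<bullet> x \<le> (norm x)\<^sup>2"
  shows "\<exists>J. pos_op J \<and> (\<forall>x. J (J x) = x - A x)"
proof -
  let ?B = "sqrt_iter A"
  have B: "pos_op (?B k)" for k
    using sqrt_iter_props[OF A] pos_op_nonneg_poly[OF A] by blast
  have nA: "norm (A x) \<le> norm x" for x
    using pos_op_norm_le[OF A, of 1] le by simp
  have nB: "norm (?B k x) \<le> norm x" for k x
  proof (induction k arbitrary: x)
    case (Suc k)
    have "norm (?B (Suc k) x) \<le> (1/2) * (norm (A x) + norm (?B k (?B k x)))"
      using norm_triangle_ineq[of "A x" "?B k (?B k x)"] by simp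
    also have "\<dots> \<le> norm x"
      using nA[of x] Suc.IH[of "?B k x"] Suc.IH[of x] by simp
    finally show ?case .
  qed simp
  define X where "X k x = x - ?B k x" for k x
  have Xpos: "pos_op (X k)" for k
  proof -
    have "?B k x \<bullet> x \<le> x \<bullet> x" for x
    proof -
      have "?B k x \<bullet> x \<le> norm (?B k x) * norm x" by (rule norm_cauchy_schwarz)
      also have "\<dots> \<le> norm x * norm x" by (intro mult_right_mono nB) auto
      finally show ?thesis by (simp add: power2_norm_eq_inner[symmetric] power2_eq_square)
    qed
    then show ?thesis unfolding X_def by (rule pos_op_diff[OF pos_op_id B])
  qed
  have Xdec: "X (Suc k) x \<bullet> x \<le> X k x \<bullet> x" for k x
  proof -
    have "pos_op (\<lambda>x. ?B (Suc k) x - ?B k x)"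
      using sqrt_iter_props[OF A, of k] pos_op_nonneg_poly[OF A] by blast
    then show ?thesis using pos_opD(3)[of "\<lambda>x. ?B (Suc k) x - ?B k x" x]
      by (simp add: X_def inner_diff_left del: sqrt_iter.simps)
  qed
  obtain J where J: "pos_op J" "\<And>x. (\<lambda>k. X k x) \<longlonglongrightarrow> J x"
    using pos_op_decseq_limit[of X, OF Xpos Xdec] by blast
  define L where "L x = x - J x" for x
  have lim: "(\<lambda>k. ?B k x) \<longlonglongrightarrow> L x" for x
    using tendsto_diff[OF tendsto_const[of x] J(2)[of x]] by (simp add: L_def X_def)
  \<comment> \<open>Strong convergence passes to the product because the iterates are uniformly
    bounded by \<open>nB\<close>.\<close>
  have lim2: "(\<lambda>k. ?B k (?B k x)) \<longlonglongrightarrow> L (L x)" for x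
  proof -
    have "(\<lambda>k. ?B k (?B k x - L x)) \<longlonglongrightarrow> 0"
    proof (rule Lim_null_comparison)
      show "\<forall>\<^sub>F k in sequentially. norm (?B k (?B k x - L x)) \<le> norm (?B k x - L x)"
        using nB by simp
      show "(\<lambda>k. norm (?B k x - L x)) \<longlonglongrightarrow> 0"
        using lim[of x] by (simp add: LIM_zero tendsto_norm_zero)
    qed
    from tendsto_add[OF this lim[of "L x"]] show ?thesis
      by (simp add: bop_simps(3)[OF pos_opD(1)[OF B]])
  qed
  have "J (J x) = x - A x" for x
  proof -
    have "(\<lambda>k. (1/2) *\<^sub>R (A x + ?B k (?B k x))) \<longlonglongrightarrow> (1/2) *\<^sub>R (A x + L (L x))"
      by (intro tendsto_intros lim2)
    moreover have "(\<lambda>k. (1/2) *\<^sub>R (A x + ?B k (?B k x))) \<longlonglongrightarrow> L x"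
      using LIMSEQ_Suc[OF lim[of x]] by simp
    ultimately have "L x = (1/2) *\<^sub>R (A x + L (L x))" by (rule LIMSEQ_unique[symmetric])
    from arg_cong[OF this, of "scaleR 2"] have "2 *\<^sub>R L x = A x + L (L x)" by simp
    moreover have "L (L x) = x - J x - J x + J (J x)"
      by (simp add: L_def bop_simps(3)[OF pos_opD(1)[OF J(1)]])
    moreover have "2 *\<^sub>R L x = (x - J x) + (x - J x)" by (simp add: L_def scaleR_2)
    ultimately show ?thesis by (simp add: algebra_simps)
  qed
  then show ?thesis using J(1) by blast
qed

lemma pos_op_sqrt:
  assumes R: "pos_op R"
  shows "\<exists>J. pos_op J \<and> (\<forall>x. J (J x) = R x)"
proof -
  \<comment> \<open>The added 1 makes \<open>c\<close> positive also for \<open>R = 0\<close>; then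
    \<open>1 - R / c\<close> meets the hypotheses of the contractive case.\<close>
  define c where "c = onorm R + 1"
  have c: "0 < c" unfolding c_def using onorm_pos_le[OF bopD(1)[OF pos_opD(1)[OF R]]] by simp
  have R1: "pos_op (\<lambda>x. (1/c) *\<^sub>R R x)" using pos_op_scaleR[OF R, of "1/c"] c by simp
  have Rc: "((1/c) *\<^sub>R R x) \<bullet> x \<le> x \<bullet> x" for x
  proof -
    have "R x \<bullet> x \<le> onorm R * (norm x)\<^sup>2" by (rule inner_le_onorm[OF pos_opD(1)[OF R]])
    also have "\<dots> \<le> c * (norm x)\<^sup>2" by (intro mult_right_mono) (simp_all add: c_def)
    finally show ?thesis using c by (simp add: power2_norm_eq_inner pos_divide_le_eq mult.commute)
  qed
  define A where "A x = x - (1/c) *\<^sub>R R x" for x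
  have "pos_op A" unfolding A_def by (rule pos_op_diff[OF pos_op_id R1 Rc])
  moreover have "A x \<bullet> x \<le> (norm x)\<^sup>2" for x
    using pos_opD(3)[OF R1, of x] unfolding A_def inner_diff_left power2_norm_eq_inner by linarith
  ultimately obtain J where J: "pos_op J" "\<And>x. J (J x) = x - A x"
    using pos_op_sqrt_contraction[of A] by blast
  show ?thesis
  proof (intro exI conjI allI)
    show "pos_op (\<lambda>x. sqrt c *\<^sub>R J x)" using c by (intro pos_op_scaleR J(1)) simp
    show "sqrt c *\<^sub>R J (sqrt c *\<^sub>R J x) = R x" for x
      using c by (simp add: bop_simps(4)[OF pos_opD(1)[OF J(1)]] J(2) A_def)
  qed
qed

section \<open>Extension and interpolation of positive forms\<close>

lemma abs_inner_le_mult: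
  fixes x :: "'a::real_inner"
  assumes "norm x \<le> c * norm y" shows "\<bar>x \<bullet> u\<bar> \<le> (c * norm u) * norm y"
proof -
  have "\<bar>x \<bullet> u\<bar> \<le> norm x * norm u" by (rule Cauchy_Schwarz_ineq2)
  also have "\<dots> \<le> (c * norm y) * norm u" by (intro mult_right_mono assms) auto
  finally show ?thesis by (simp add: mult_ac)
qed

text \<open>\<open>x \<mapsto> Q x\<close> is represented by a map \<open>z\<close> into the closure of \<open>J ` E\<close>, and \<open>Z\<close> is the
  transpose of \<open>z\<close>, which makes it vanish on the orthogonal complement of \<open>J ` E\<close>.\<close>
lemma pos_op_form_extension:
  fixes Q :: "'a::complex_hilbert \<Rightarrow> 'a \<Rightarrow> real" and J :: "'a \<Rightarrow> 'b::complex_hilbert"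
  assumes E: "subspace E" and iE: "\<And>x. x \<in> E \<Longrightarrow> iscale x \<in> E" and J: "bop J" and c: "0 \<le> c"
    and add: "\<And>x y z. x \<in> E \<Longrightarrow> y \<in> E \<Longrightarrow> z \<in> E \<Longrightarrow> Q (x + y) z = Q x z + Q y z"
    and scale: "\<And>r x z. x \<in> E \<Longrightarrow> z \<in> E \<Longrightarrow> Q (r *\<^sub>R x) z = r * Q x z"
    and sym: "\<And>x z. x \<in> E \<Longrightarrow> z \<in> E \<Longrightarrow> Q x z = Q z x"
    and isc: "\<And>x z. x \<in> E \<Longrightarrow> z \<in> E \<Longrightarrow> Q (iscale x) (iscale z) = Q x z"
    and pos: "\<And>x. x \<in> E \<Longrightarrow> 0 \<le> Q x x"
    and le: "\<And>x. x \<in> E \<Longrightarrow> Q x x \<le> c * (norm (J x))\<^sup>2"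
  shows "\<exists>Z. pos_op Z \<and> (\<forall>x. Z x \<bullet> x \<le> c * (norm x)\<^sup>2) \<and> (\<forall>x\<in>E. \<forall>y\<in>E. Z (J x) \<bullet> J y = Q x y)"
proof -
  define M where "M = closure (J ` E)"
  have linJ: "linear J" using J by (simp add: bopD bounded_linear.linear)
  have JE: "subspace (J ` E)" by (rule linear_subspace_image[OF linJ E])
  have M: "subspace M" unfolding M_def by (rule closure_subspace[OF JE])
  have iM: "iscale x \<in> M" if "x \<in> M" for x
  proof -
    have "iscale ` closure (J ` E) \<subseteq> closure (iscale ` (J ` E))"
      by (rule closure_bounded_linear_image_subset[OF bounded_linear_iscale])
    also have "\<dots> \<subseteq> closure (J ` E)"
      using iE by (intro closure_mono) (auto simp flip: bopD(2)[OF J])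
    finally show ?thesis using that unfolding M_def by blast
  qed
  have JM: "J x \<in> M" if "x \<in> E" for x
    unfolding M_def by (rule subsetD[OF closure_subset imageI[OF that]])
  have eqI: "u = v" if "u \<in> M" "v \<in> M" "\<And>x. x \<in> E \<Longrightarrow> J x \<bullet> u = J x \<bullet> v" for u v
    by (rule closure_inner_eqI[OF JE]) (use that in \<open>auto simp: M_def\<close>)
  have closedI: "\<And>x. x \<in> M \<Longrightarrow> P x" if "closed {x. P x}" "\<And>x. x \<in> E \<Longrightarrow> P (J x)" for P
    using closure_minimal[of "J ` E" "{x. P x}"] that unfolding M_def by blast
  have normI: "norm u \<le> b" if "u \<in> M" "0 \<le> b" "\<And>x. x \<in> E \<Longrightarrow> J x \<bullet> u \<le> b * norm (J x)" for u b
  proof -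
    have "norm u \<le> b \<or> u = 0"
      by (rule closure_inner_norm_le[where S = "J ` E"]) (use that in \<open>auto simp: M_def\<close>)
    then show ?thesis using that(2) by auto
  qed

  \<comment> \<open>The bound is in terms of \<open>J x\<close> and \<open>J y\<close> alone, so
    \<open>Q\<close> is a bounded form on the image of \<open>E\<close> even where \<open>J\<close>
    is not injective.\<close>
  have Qbd: "\<bar>Q x y\<bar> \<le> (c * norm (J x)) * norm (J y)" if "x \<in> E" "y \<in> E" for x y
  proof -
    have "(Q x y)\<^sup>2 \<le> Q x x * Q y y"
      by (rule form_Cauchy_Schwarz[OF E that add scale sym pos])
    also have "\<dots> \<le> (c * (norm (J x))\<^sup>2) * (c * (norm (J y))\<^sup>2)"
      using that c by (intro mult_mono le pos) auto
    also have "\<dots> = ((c * norm (J x)) * norm (J y))\<^sup>2" by (simp add: power_mult_distrib power2_eq_square)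
    finally show ?thesis using c by (simp add: abs_le_square_iff[symmetric])
  qed
  have "\<exists>w. w \<in> M \<and> (\<forall>y\<in>E. Q x y = J y \<bullet> w)" if "x \<in> E" for x
    using Riesz_factor[OF E linJ, of "Q x" "c * norm (J x)"] Qbd[OF that]
      add[OF _ _ that] scale[OF _ that] sym[OF that]
    unfolding M_def by (metis E subspace_add subspace_scale)
  then obtain z where zM: "\<And>x. x \<in> E \<Longrightarrow> z x \<in> M"
    and z: "\<And>x y. x \<in> E \<Longrightarrow> y \<in> E \<Longrightarrow> J y \<bullet> z x = Q x y" by metis
  have z_norm: "norm (z x) \<le> c * norm (J x)" if "x \<in> E" for x
    using that c Qbd by (intro normI zM) (auto simp: z abs_le_iff)
  have z_add: "z (x + y) = z x + z y" if "x \<in> E" "y \<in> E" for x y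
    using that E M by (intro eqI) (auto simp: zM z subspace_add inner_add_right add)
  have z_scale: "z (r *\<^sub>R x) = r *\<^sub>R z x" if "x \<in> E" for x r
    using that E M by (intro eqI) (auto simp: zM z subspace_scale scale)
  \<comment> \<open>\<open>Q\<close> is invariant under applying \<open>iscale\<close> to both
    arguments; moving a single \<open>iscale\<close> across costs the sign of
    \<open>iscale (iscale y) = - y\<close>.\<close>
  have z_iscale: "z (iscale x) = iscale (z x)" if x: "x \<in> E" for x
  proof (rule eqI)
    fix y assume y: "y \<in> E"
    have y': "iscale (iscale y) = (-1) *\<^sub>R y" by (simp add: iscale_iscale)
    have "Q (iscale x) y = - Q (iscale x) (iscale (iscale y))"
      unfolding y' using scale[OF y iE[OF x], of "-1"] sym iE x y
      by (metis E subspace_scale mult_minus1 minus_minus)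
    also have "\<dots> = - Q x (iscale y)" using isc iE x y by simp
    finally have "Q (iscale x) y = - (J (iscale y) \<bullet> z x)" using x y iE by (simp add: z)
    then show "J y \<bullet> z (iscale x) = J y \<bullet> iscale (z x)"
      using x y iE by (simp add: z bopD(2)[OF J] inner_iscale_left)
  qed (use x iE iM zM in auto)

  \<comment> \<open>A second use of Riesz, now for the functional
    \<open>x \<mapsto> z x \<bullet> u\<close>; taking the representative in \<open>M\<close> makes
    it unique, which yields linearity of \<open>Z\<close>.\<close>
  have "\<exists>w. w \<in> M \<and> (\<forall>x\<in>E. z x \<bullet> u = J x \<bullet> w)" for u
    using Riesz_factor[OF E linJ, of "\<lambda>x. z x \<bullet> u" "c * norm u"]
      abs_inner_le_mult[OF z_norm]
    unfolding M_def by (simp add: z_add z_scale inner_add_left) blast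
  then obtain Z where ZM: "\<And>u. Z u \<in> M"
    and Z: "\<And>x u. x \<in> E \<Longrightarrow> J x \<bullet> Z u = z x \<bullet> u" by metis
  have Z_norm: "norm (Z u) \<le> norm u * c" for u
    using c abs_inner_le_mult[OF z_norm, of _ u]
    by (intro normI ZM) (auto simp: Z abs_le_iff mult_ac)
  have blZ: "bounded_linear Z"
  proof (rule bounded_linear_intro[OF _ _ Z_norm])
    show "Z (u + v) = Z u + Z v" for u v
      using M by (intro eqI) (auto simp: ZM Z subspace_add inner_add_right)
    show "Z (r *\<^sub>R u) = r *\<^sub>R Z u" for r u
      using M by (intro eqI) (auto simp: ZM Z subspace_scale)
  qed
  have "Z (iscale u) = iscale (Z u)" for u
  proof (rule eqI)
    fix x assume x: "x \<in> E"
    have "z x \<bullet> iscale u = - (z (iscale x) \<bullet> u)" by (simp add: z_iscale x inner_iscale_left)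
    also have "\<dots> = - (J (iscale x) \<bullet> Z u)" by (simp add: Z iE x)
    also have "\<dots> = J x \<bullet> iscale (Z u)" by (simp add: bopD(2)[OF J] inner_iscale_left)
    finally show "J x \<bullet> Z (iscale u) = J x \<bullet> iscale (Z u)" by (simp add: Z x)
  qed (simp_all add: ZM iM)
  then have bZ: "bop Z" using blZ by (simp add: bop_def)
  have ZJ: "Z (J x) \<bullet> J y = Q x y" if "x \<in> E" "y \<in> E" for x y
    using that Z[of y "J x"] z[of y x] sym by (simp add: inner_commute)
  have contZ: "continuous_on UNIV Z" by (rule linear_continuous_on[OF blZ])
  note cont = continuous_on_compose2[OF contZ] continuous_intros

  \<comment> \<open>On the image of \<open>E\<close> symmetry is that of \<open>Q\<close>; it
    reaches \<open>M\<close> by closure in one variable at a time.\<close>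
  have symM: "Z a \<bullet> b = a \<bullet> Z b" if "a \<in> M" "b \<in> M" for a b
  proof (rule closedI[OF _ _ that(2)])
    fix y assume y: "y \<in> E"
    show "Z a \<bullet> J y = a \<bullet> Z (J y)"
    proof (rule closedI[OF _ _ that(1)])
      show "Z (J x) \<bullet> J y = J x \<bullet> Z (J y)" if "x \<in> E" for x
        using ZJ that y sym by (simp add: inner_commute)
    qed (intro closed_Collect_eq cont; simp)
  qed (intro closed_Collect_eq cont; simp)
  have posM: "0 \<le> Z a \<bullet> a" if "a \<in> M" for a
    by (rule closedI[OF _ _ that]) (auto simp: ZJ pos intro!: closed_Collect_le cont)

  \<comment> \<open>\<open>p\<close> is the orthogonal projection onto \<open>M\<close>. Since
    \<open>Z\<close> takes values in \<open>M\<close> and satisfies \<open>Z (p u) = Z u\<close>,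
    symmetry and positivity on \<open>M\<close> extend to the whole space.\<close>
  have "\<exists>w. w \<in> M \<and> (\<forall>x\<in>E. J x \<bullet> u = J x \<bullet> w)" for u
    using Riesz_factor[OF E linJ, of "\<lambda>x. J x \<bullet> u" "1 * norm u"]
      abs_inner_le_mult[of "J x" 1 "J x" u for x]
    unfolding M_def by (simp add: bop_simps(2,4)[OF J] inner_add_left) blast
  then obtain p where pM: "\<And>u. p u \<in> M"
    and pJ: "\<And>x u. x \<in> E \<Longrightarrow> J x \<bullet> p u = J x \<bullet> u" by metis
  have p: "m \<bullet> p u = m \<bullet> u" if "m \<in> M" for m u
    by (rule closedI[OF _ _ that]) (auto simp: pJ intro!: closed_Collect_eq cont)
  have p_norm: "norm (p u) \<le> norm u" for u
    using norm_cauchy_schwarz[of "J x" u for x] by (intro normI) (auto simp: pM pJ mult.commute[of "norm u"])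
  have Zp: "Z (p u) = Z u" for u
    by (rule eqI) (auto simp: ZM Z p zM)
  have ZZ: "Z u \<bullet> v = Z (p u) \<bullet> p v" for u v by (simp add: Zp p ZM)
  show ?thesis
  proof (intro exI[of _ Z] conjI allI ballI)
    show "pos_op Z"
      unfolding pos_op_iff
    proof (intro conjI allI bZ)
      show "Z u \<bullet> v = u \<bullet> Z v" for u v
        using ZZ[of u v] ZZ[of v u] symM[OF pM pM] by (simp add: inner_commute)
      show "0 \<le> Z u \<bullet> u" for u by (simp add: ZZ[of u u] posM pM)
    qed
    show "Z u \<bullet> u \<le> c * (norm u)\<^sup>2" for u
    proof -
      have "Z u \<bullet> u \<le> norm (Z u) * norm u" by (rule norm_cauchy_schwarz)
      also have "\<dots> \<le> (norm u * c) * norm u" by (intro mult_right_mono Z_norm) auto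
      finally show ?thesis by (simp add: power2_eq_square mult_ac)
    qed
  qed (rule ZJ)
qed

text \<open>Sought in the shape \<open>X + J Z J\<close>, where \<open>J\<close> is the square root
  of \<open>c - X\<close> and \<open>Z\<close> lies between 0 and 1, which enforces both bounds.
  Agreement with \<open>D\<close> on \<open>E\<close> prescribes the form of \<open>Z\<close> on the
  image of \<open>E\<close> under \<open>J\<close> as that of \<open>D - X\<close>: nonnegative by
  \<open>le\<close>, and at most \<open>(norm (J x))\<^sup>2\<close> because \<open>D\<close> is
  bounded by \<open>c\<close>.\<close>

lemma pos_op_interpolation:
  assumes E: "subspace E" and iE: "\<And>x. x \<in> E \<Longrightarrow> iscale x \<in> E"
    and X: "pos_op X" and D: "pos_op D"
    and Xc: "\<And>x. X x \<bullet> x \<le> c * (norm x)\<^sup>2" and Dc: "\<And>x. D x \<bullet> x \<le> c * (norm x)\<^sup>2"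
    and c: "0 \<le> c" and le: "\<And>x. x \<in> E \<Longrightarrow> X x \<bullet> x \<le> D x \<bullet> x"
  shows "\<exists>D'. pos_op D' \<and> (\<forall>x. X x \<bullet> x \<le> D' x \<bullet> x) \<and> (\<forall>x. D' x \<bullet> x \<le> c * (norm x)\<^sup>2) \<and>
    (\<forall>x\<in>E. \<forall>y\<in>E. D' x \<bullet> y = D x \<bullet> y)"
proof -
  have "pos_op (\<lambda>x. c *\<^sub>R x - X x)"
    using Xc by (intro pos_op_diff[OF pos_op_scaleR[OF pos_op_id c] X]) (simp add: power2_norm_eq_inner)
  then obtain J where J: "pos_op J" "\<And>x. J (J x) = c *\<^sub>R x - X x" using pos_op_sqrt by blast
  have JJ: "J x \<bullet> J y = c * (x \<bullet> y) - X x \<bullet> y" for x y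
    using pos_opD(2)[OF J(1), of "J x" y] J(2)[of x] by (simp add: inner_diff_left)
  have iX: "X (iscale x) \<bullet> iscale y = X x \<bullet> y" and iD: "D (iscale x) \<bullet> iscale y = D x \<bullet> y" for x y
    by (simp_all add: bopD(2)[OF pos_opD(1)[OF X]] bopD(2)[OF pos_opD(1)[OF D]] inner_iscale)
  obtain Z where Z: "pos_op Z" "\<And>x. Z x \<bullet> x \<le> 1 * (norm x)\<^sup>2"
    "\<And>x y. x \<in> E \<Longrightarrow> y \<in> E \<Longrightarrow> Z (J x) \<bullet> J y = D x \<bullet> y - X x \<bullet> y"
  proof -
    have "\<exists>Z. pos_op Z \<and> (\<forall>x. Z x \<bullet> x \<le> 1 * (norm x)\<^sup>2) \<and>
        (\<forall>x\<in>E. \<forall>y\<in>E. Z (J x) \<bullet> J y = D x \<bullet> y - X x \<bullet> y)"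
    proof (rule pos_op_form_extension[OF E iE pos_opD(1)[OF J(1)]])
      show "D x \<bullet> x - X x \<bullet> x \<le> 1 * (norm (J x))\<^sup>2" if "x \<in> E" for x
        using Dc[of x] by (simp add: JJ power2_norm_eq_inner)
      show "D x \<bullet> z - X x \<bullet> z = D z \<bullet> x - X z \<bullet> x" for x z
        by (simp add: pos_opD(2)[OF X, of x] pos_opD(2)[OF D, of x] inner_commute[of x])
    qed (auto simp: le iX iD bop_simps(2,4)[OF pos_opD(1)[OF X]] bop_simps(2,4)[OF pos_opD(1)[OF D]]
        inner_add_left algebra_simps)
    then show ?thesis using that by blast
  qed
  define D' where "D' x = X x + J (Z (J x))" for x
  have inner: "D' x \<bullet> y = X x \<bullet> y + Z (J x) \<bullet> J y" for x y
    using pos_opD(2)[OF J(1), of "Z (J x)" y] by (simp add: D'_def inner_add_left)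
  have "bop D'"
    unfolding D'_def
    using pos_opD(1)[OF X] pos_opD(1)[OF J(1)] pos_opD(1)[OF Z(1)]
    by (intro bop_add[OF _ bop_compose[OF _ bop_compose]])
  then have "pos_op D'"
    unfolding pos_op_iff using pos_opD(2,3)[OF X] pos_opD(2,3)[OF Z(1)] inner
    by (metis add_nonneg_nonneg inner_commute)
  moreover have "X x \<bullet> x \<le> D' x \<bullet> x" for x using pos_opD(3)[OF Z(1)] by (simp add: inner)
  moreover have "D' x \<bullet> x \<le> c * (norm x)\<^sup>2" for x
    using Z(2)[of "J x"] by (simp add: inner JJ power2_norm_eq_inner)
  moreover have "D' x \<bullet> y = D x \<bullet> y" if "x \<in> E" "y \<in> E" for x y
    using Z(3)[OF that] by (simp add: inner)
  ultimately show ?thesis by blast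
qed

section \<open>Row isometries\<close>

text \<open>By Pythagoras the squared norm of a block of terms is a block of the numerical series.
  Square summability does not give absolute convergence, hence the Cauchy argument over finite
  subsets.\<close>

lemma orthogonal_summable_on:
  fixes f :: "'i \<Rightarrow> 'a::{real_inner,banach}"
  assumes orth: "\<And>i j. i \<in> A \<Longrightarrow> j \<in> A \<Longrightarrow> i \<noteq> j \<Longrightarrow> f i \<bullet> f j = 0"
    and summ: "(\<lambda>i. (norm (f i))\<^sup>2) summable_on A"
  shows "f summable_on A"
proof -
  define s where "s F = (\<Sum>i\<in>F. (norm (f i))\<^sup>2)" for F
  define L where "L = infsum (\<lambda>i. (norm (f i))\<^sup>2) A"
  have L: "((\<lambda>i. (norm (f i))\<^sup>2) has_sum L) A" unfolding L_def using summ by simp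
  have sL: "s F \<le> L" if "finite F" "F \<subseteq> A" for F
    unfolding s_def by (rule finite_sum_le_has_sum[OF L that]) simp
  have norm_sum: "(norm (sum f F))\<^sup>2 = s F" if "finite F" "F \<subseteq> A" for F
    unfolding s_def using that orth
    by (intro norm_sum_Pythagorean) (auto simp: pairwise_def orthogonal_def)
  have "\<exists>P. eventually P (finite_subsets_at_top A) \<and>
      (\<forall>F G. P F \<and> P G \<longrightarrow> dist (sum f F) (sum f G) < e)" if e: "e > 0" for e
  proof -
    \<comment> \<open>The square appears because the numerical series controls squared norms; two
      errors of at most \<open>e/4\<close> add up to less than \<open>e\<close>.\<close>
    obtain F0 where F0: "finite F0" "F0 \<subseteq> A" "dist (s F0) L \<le> (e/4)\<^sup>2"
      using has_sum_finite_approximation[OF L, of "(e/4)\<^sup>2"] e unfolding s_def by auto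
    define P where "P F \<longleftrightarrow> finite F \<and> F0 \<subseteq> F \<and> F \<subseteq> A" for F
    have near: "norm (sum f F - sum f F0) \<le> e/4" if "P F" for F
    proof -
      have F: "finite F" "F0 \<subseteq> F" "F \<subseteq> A" using that by (auto simp: P_def)
      have "(norm (sum f (F - F0)))\<^sup>2 = s (F - F0)" using F by (intro norm_sum) auto
      also have "\<dots> = s F - s F0" unfolding s_def using F F0 by (simp add: sum_diff)
      also have "\<dots> \<le> (e/4)\<^sup>2" using sL[of F] F F0 by (auto simp: dist_real_def)
      finally have "norm (sum f (F - F0)) \<le> e/4" by (rule power2_le_imp_le) (use e in simp)
      then show ?thesis using F F0 by (simp add: sum_diff)
    qed
    have "dist (sum f F) (sum f G) < e" if "P F" "P G" for F G
    proof -
      have "dist (sum f F) (sum f G) \<le> dist (sum f F) (sum f F0) + dist (sum f G) (sum f F0)"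
        by (rule dist_triangle2)
      then show ?thesis using near[OF that(1)] near[OF that(2)] e by (simp add: dist_norm)
    qed
    moreover have "eventually P (finite_subsets_at_top A)"
      unfolding eventually_finite_subsets_at_top P_def using F0 by blast
    ultimately show ?thesis by blast
  qed
  then have "cauchy_filter (filtermap (sum f) (finite_subsets_at_top A))"
    by (simp add: cauchy_filter_metric_filtermap)
  then obtain l where "(sum f \<longlongrightarrow> l) (finite_subsets_at_top A)"
    using complete_uniform[where S="UNIV :: 'a set"] complete_UNIV by (force simp add: filterlim_def)
  then show ?thesis using summable_on_def has_sum_def by blast
qed

locale row_isometry =
  fixes n :: enat and V :: "nat \<Rightarrow> 'k::complex_hilbert \<Rightarrow> 'k"
  assumes bopV: "i \<in> idx n \<Longrightarrow> bop (V i)"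
    and normV: "i \<in> idx n \<Longrightarrow> norm (V i x) = norm x"
    and orthV: "i \<in> idx n \<Longrightarrow> j \<in> idx n \<Longrightarrow> i \<noteq> j \<Longrightarrow> V i x \<bullet> V j y = 0"
begin

lemma innerV: "i \<in> idx n \<Longrightarrow> V i x \<bullet> V i y = x \<bullet> y"
  by (rule isometry_inner[OF bopV normV])

lemma cadj_V: "i \<in> idx n \<Longrightarrow> j \<in> idx n \<Longrightarrow> cadj (V i) (V j x) = (if i = j then x else 0)"
  by (rule cadj_eqI[OF bopV]) (auto simp: innerV orthV)

lemma sum_norm_V:
  assumes "finite F" "F \<subseteq> idx n"
  shows "(norm (\<Sum>i\<in>F. V i (g i)))\<^sup>2 = (\<Sum>i\<in>F. (norm (g i))\<^sup>2)"
proof -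
  have "(norm (\<Sum>i\<in>F. V i (g i)))\<^sup>2 = (\<Sum>i\<in>F. (norm (V i (g i)))\<^sup>2)"
    using assms by (intro norm_sum_Pythagorean) (auto simp: pairwise_def orthogonal_def intro!: orthV)
  also have "\<dots> = (\<Sum>i\<in>F. (norm (g i))\<^sup>2)"
    using assms by (intro sum.cong) (auto simp: normV)
  finally show ?thesis .
qed

text \<open>Expanding the squared distance from \<open>h\<close> to its projection \<open>u\<close>
  onto the ranges of finitely many \<open>V i\<close>. All upper bounds for \<open>phi n V\<close>
  rest on this estimate.\<close>

lemma Bessel:
  assumes F: "finite F" "F \<subseteq> idx n"
  shows "(\<Sum>i\<in>F. (norm (cadj (V i) h))\<^sup>2) \<le> (norm h)\<^sup>2"
proof -
  define u where "u = (\<Sum>i\<in>F. V i (cadj (V i) h))"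
  have "u \<bullet> h = (\<Sum>i\<in>F. (norm (cadj (V i) h))\<^sup>2)"
    unfolding u_def inner_sum_left
    using F by (intro sum.cong) (auto simp: power2_norm_eq_inner inner_cadj[OF bopV])
  moreover have "(norm u)\<^sup>2 = (\<Sum>i\<in>F. (norm (cadj (V i) h))\<^sup>2)"
    unfolding u_def by (rule sum_norm_V[OF F])
  moreover have "(norm (h - u))\<^sup>2 = (norm h)\<^sup>2 - 2 * (u \<bullet> h) + (norm u)\<^sup>2"
    unfolding power2_norm_eq_inner by (simp add: inner_diff_left inner_diff_right inner_commute)
  moreover have "0 \<le> (norm (h - u))\<^sup>2" by simp
  ultimately show ?thesis by linarith
qed

lemma sum_phi_le:
  assumes X: "bop X" and F: "finite F" "F \<subseteq> idx n"
  shows "(\<Sum>i\<in>F. (norm (X (cadj (V i) h)))\<^sup>2) \<le> (onorm X * norm h)\<^sup>2"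
proof -
  have "(\<Sum>i\<in>F. (norm (X (cadj (V i) h)))\<^sup>2) \<le> (\<Sum>i\<in>F. (onorm X)\<^sup>2 * (norm (cadj (V i) h))\<^sup>2)"
    unfolding power_mult_distrib[symmetric]
    by (intro sum_mono power_mono onorm[OF bopD(1)[OF X]]) simp
  also have "\<dots> = (onorm X)\<^sup>2 * (\<Sum>i\<in>F. (norm (cadj (V i) h))\<^sup>2)" by (simp add: sum_distrib_left)
  also have "\<dots> \<le> (onorm X)\<^sup>2 * (norm h)\<^sup>2" by (intro mult_left_mono Bessel F) simp
  finally show ?thesis by (simp add: power_mult_distrib)
qed

text \<open>\<open>infsum\<close> defaults to 0 when there is no sum, so existence has to be
  secured: the terms lie in mutually orthogonal ranges and \<open>Bessel\<close> bounds the sums of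
  their squared norms.\<close>

lemma has_sum_phi:
  assumes X: "bop X"
  shows "((\<lambda>i. V i (X (cadj (V i) h))) has_sum phi n V X h) (idx n)"
proof -
  have "(\<lambda>i. V i (X (cadj (V i) h))) summable_on idx n"
  proof (rule orthogonal_summable_on)
    have "(\<lambda>i. (norm (X (cadj (V i) h)))\<^sup>2) summable_on idx n"
      by (rule nonneg_bounded_partial_sums_imp_summable_on[where C = "(onorm X * norm h)\<^sup>2"])
        (auto intro!: eventually_finite_subsets_at_top_weakI sum_phi_le[OF X])
    then show "(\<lambda>i. (norm (V i (X (cadj (V i) h))))\<^sup>2) summable_on idx n"
      by (subst summable_on_cong[where g = "\<lambda>i. (norm (X (cadj (V i) h)))\<^sup>2"]) (simp_all add: normV)
  qed (rule orthV)
  then show ?thesis unfolding phi_def by simp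
qed

lemma has_sum_inner_phi:
  assumes X: "bop X"
  shows "((\<lambda>i. X (cadj (V i) x) \<bullet> cadj (V i) y) has_sum (phi n V X x \<bullet> y)) (idx n)"
proof -
  have "((\<lambda>i. V i (X (cadj (V i) x)) \<bullet> y) has_sum (phi n V X x \<bullet> y)) (idx n)"
    by (rule has_sum_bounded_linear[OF bounded_linear_inner_left has_sum_phi[OF X]])
  then show ?thesis
    by (subst has_sum_cong[where g = "\<lambda>i. V i (X (cadj (V i) x)) \<bullet> y"]) (simp_all add: inner_cadj[OF bopV])
qed

lemma bop_phi:
  assumes X: "bop X" shows "bop (phi n V X)"
proof -
  note [simp] = bopV bop_cadj bop_simps[OF X]
  note hs = has_sum_phi[OF X]
  have eqI: "phi n V X x = s"
    if "((\<lambda>i. V i (X (cadj (V i) x))) has_sum s) (idx n)" for x s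
    by (rule has_sum_unique[OF hs that])
  have "norm (phi n V X h) \<le> norm h * onorm X" for h
  proof (rule Lim_norm_ubound)
    show "(sum (\<lambda>i. V i (X (cadj (V i) h))) \<longlongrightarrow> phi n V X h) (finite_subsets_at_top (idx n))"
      using hs unfolding has_sum_def .
    show "\<forall>\<^sub>F F in finite_subsets_at_top (idx n). norm (\<Sum>i\<in>F. V i (X (cadj (V i) h))) \<le> norm h * onorm X"
    proof (rule eventually_finite_subsets_at_top_weakI)
      fix F assume F: "finite F" "F \<subseteq> idx n"
      have "(norm (\<Sum>i\<in>F. V i (X (cadj (V i) h))))\<^sup>2 \<le> (onorm X * norm h)\<^sup>2"
        unfolding sum_norm_V[OF F] by (rule sum_phi_le[OF X F])
      then show "norm (\<Sum>i\<in>F. V i (X (cadj (V i) h))) \<le> norm h * onorm X"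
        unfolding mult.commute[of "norm h"]
        by (rule power2_le_imp_le) (simp add: onorm_pos_le[OF bopD(1)[OF X]])
    qed
  qed simp
  moreover have "phi n V X (x + y) = phi n V X x + phi n V X y" for x y
  proof (rule eqI)
    show "((\<lambda>i. V i (X (cadj (V i) (x + y)))) has_sum (phi n V X x + phi n V X y)) (idx n)"
      using has_sum_add[OF hs hs, of x y]
      by (subst has_sum_cong[where g = "\<lambda>i. V i (X (cadj (V i) x)) + V i (X (cadj (V i) y))"])
        (simp_all add: bop_simps(2))
  qed
  moreover have "phi n V X (r *\<^sub>R x) = r *\<^sub>R phi n V X x" for r x
  proof (rule eqI)
    show "((\<lambda>i. V i (X (cadj (V i) (r *\<^sub>R x)))) has_sum (r *\<^sub>R phi n V X x)) (idx n)"
      using has_sum_scaleR[OF hs, of r x]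
      by (subst has_sum_cong[where g = "\<lambda>i. r *\<^sub>R V i (X (cadj (V i) x))"]) (simp_all add: bop_simps(4))
  qed
  moreover have "phi n V X (iscale x) = iscale (phi n V X x)" for x
  proof (rule eqI)
    show "((\<lambda>i. V i (X (cadj (V i) (iscale x)))) has_sum iscale (phi n V X x)) (idx n)"
      using has_sum_bounded_linear[OF bounded_linear_iscale hs, of x]
      by (subst has_sum_cong[where g = "\<lambda>i. iscale (V i (X (cadj (V i) x)))"]) (simp_all add: bop_simps(1))
  qed
  ultimately show ?thesis
    unfolding bop_def by (intro conjI allI bounded_linear_intro[where K = "onorm X"]) auto
qed

lemma phi_form_eq:
  assumes "bop X" "bop Y"
    and "\<And>i. i \<in> idx n \<Longrightarrow> X (cadj (V i) x) \<bullet> cadj (V i) y = Y (cadj (V i) x) \<bullet> cadj (V i) y"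
  shows "phi n V X x \<bullet> y = phi n V Y x \<bullet> y"
  by (rule has_sum_unique[OF has_sum_inner_phi[OF assms(1)]])
    (use has_sum_inner_phi[OF assms(2), of x y] in \<open>subst has_sum_cong[OF assms(3)]\<close>)

lemma phi_form_mono:
  assumes "bop X" "bop Y" "\<And>x. X x \<bullet> x \<le> Y x \<bullet> x"
  shows "phi n V X x \<bullet> x \<le> phi n V Y x \<bullet> x"
  by (rule has_sum_mono[OF has_sum_inner_phi[OF assms(1)] has_sum_inner_phi[OF assms(2)] assms(3)])

text \<open>Termwise use of \<open>le\<close>, then \<open>Bessel\<close>. The constant is preserved
  without loss, so one \<open>c\<close> serves at all levels of the lift.\<close>

lemma phi_form_bound:
  assumes X: "bop X" and c: "0 \<le> c" and le: "\<And>x. X x \<bullet> x \<le> c * (norm x)\<^sup>2"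
  shows "phi n V X x \<bullet> x \<le> c * (norm x)\<^sup>2"
proof (rule has_sum_le_finite_sums[OF has_sum_inner_phi[OF X]])
  fix F assume F: "finite F" "F \<subseteq> idx n"
  have "(\<Sum>i\<in>F. X (cadj (V i) x) \<bullet> cadj (V i) x) \<le> (\<Sum>i\<in>F. c * (norm (cadj (V i) x))\<^sup>2)"
    by (intro sum_mono le)
  also have "\<dots> \<le> c * (norm x)\<^sup>2"
    unfolding sum_distrib_left[symmetric] by (intro mult_left_mono Bessel F c)
  finally show "(\<Sum>i\<in>F. X (cadj (V i) x) \<bullet> cadj (V i) x) \<le> c * (norm x)\<^sup>2" .
qed

lemma pos_op_phi:
  assumes X: "pos_op X" shows "pos_op (phi n V X)"
  unfolding pos_op_iff
proof (intro conjI allI)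
  note b = pos_opD(1)[OF X]
  show "bop (phi n V X)" by (rule bop_phi[OF b])
  show "phi n V X x \<bullet> y = x \<bullet> phi n V X y" for x y
  proof -
    have "X (cadj (V i) x) \<bullet> cadj (V i) y = X (cadj (V i) y) \<bullet> cadj (V i) x" for i
      by (metis pos_opD(2)[OF X] inner_commute)
    then have "phi n V X x \<bullet> y = phi n V X y \<bullet> x"
      using has_sum_unique[OF has_sum_inner_phi[OF b, of x y]] has_sum_inner_phi[OF b, of y x] by simp
    then show ?thesis by (simp add: inner_commute)
  qed
  show "0 \<le> phi n V X x \<bullet> x" for x
    by (rule has_sum_nonneg[OF has_sum_inner_phi[OF b]]) (rule pos_opD(3)[OF X])
qed

text \<open>Orthogonality of the ranges annihilates every term except the one with index
  \<open>i\<close>.\<close>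

lemma cadj_phi:
  assumes X: "bop X" and i: "i \<in> idx n"
  shows "cadj (V i) (phi n V X x) = X (cadj (V i) x)"
proof (rule has_sum_unique)
  show "((\<lambda>j. cadj (V i) (V j (X (cadj (V j) x)))) has_sum cadj (V i) (phi n V X x)) (idx n)"
    by (rule has_sum_bounded_linear[OF bopD(1)[OF bop_cadj[OF bopV[OF i]]] has_sum_phi[OF X]])
  show "((\<lambda>j. cadj (V i) (V j (X (cadj (V j) x)))) has_sum X (cadj (V i) x)) (idx n)"
    by (rule has_sum_finite_neutralI[of "{i}"]) (use i in \<open>auto simp: cadj_V\<close>)
qed

lemma phi_inner_wandering:
  assumes X: "bop X" and y: "\<And>i. i \<in> idx n \<Longrightarrow> cadj (V i) y = 0"
  shows "phi n V X x \<bullet> y = 0"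
proof (rule has_sum_unique[OF has_sum_inner_phi[OF X]])
  show "((\<lambda>i. X (cadj (V i) x) \<bullet> cadj (V i) y) has_sum 0) (idx n)"
    by (rule has_sum_0) (simp add: y)
qed

lemma phi_diff:
  assumes X: "bop X" and Y: "bop Y"
  shows "phi n V (\<lambda>x. X x - Y x) = (\<lambda>x. phi n V X x - phi n V Y x)"
proof
  fix x
  have "((\<lambda>i. V i (X (cadj (V i) x)) + - V i (Y (cadj (V i) x))) has_sum (phi n V X x + - phi n V Y x)) (idx n)"
    by (intro has_sum_add has_sum_phi X) (simp add: has_sum_uminus has_sum_phi Y)
  then have "((\<lambda>i. V i (X (cadj (V i) x) - Y (cadj (V i) x))) has_sum (phi n V X x - phi n V Y x)) (idx n)"
    by (subst has_sum_cong[where g = "\<lambda>i. V i (X (cadj (V i) x)) + - V i (Y (cadj (V i) x))"])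
      (simp_all add: bop_simps(3)[OF bopV])
  then show "phi n V (\<lambda>x. X x - Y x) x = phi n V X x - phi n V Y x"
    unfolding phi_def[of n V "\<lambda>x. X x - Y x"] by (rule infsumI)
qed

lemma bop_phi_funpow: "bop X \<Longrightarrow> bop ((phi n V ^^ k) X)"
  by (induction k) (auto simp: bop_phi)

lemma pos_op_phi_funpow: "pos_op X \<Longrightarrow> pos_op ((phi n V ^^ k) X)"
  by (induction k) (auto simp: pos_op_phi)

text \<open>Both \<open>F\<close> and \<open>phi n V F\<close> intertwine \<open>cadj (V i)\<close> in the same way and vanish on the
  wandering subspace, hence they coincide.\<close>
lemma phi_funpow_limit:
  assumes D: "pos_op D" and le: "\<And>x. phi n V D x \<bullet> x \<le> D x \<bullet> x"
  shows "\<exists>F. pos_op F \<and> (\<forall>x. (\<lambda>k. (phi n V ^^ k) D x) \<longlonglongrightarrow> F x) \<and>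
    (\<forall>x. F x \<bullet> x \<le> D x \<bullet> x) \<and> phi n V F = F"
proof -
  define X where "X k = (phi n V ^^ k) D" for k
  have X: "pos_op (X k)" for k unfolding X_def by (rule pos_op_phi_funpow[OF D])
  have X0: "X 0 = D" and XS: "X (Suc k) = phi n V (X k)" for k by (simp_all add: X_def)
  have dec: "X (Suc k) x \<bullet> x \<le> X k x \<bullet> x" for k x
  proof (induction k arbitrary: x)
    case 0 then show ?case by (simp add: X0 XS le)
  next
    case (Suc k)
    show ?case unfolding XS[of "Suc k"] XS[of k]
      by (rule phi_form_mono) (use X Suc pos_opD(1) in \<open>auto simp flip: XS\<close>)
  qed
  obtain F where F: "pos_op F" "\<And>x. (\<lambda>k. X k x) \<longlonglongrightarrow> F x" "\<And>k x. F x \<bullet> x \<le> X k x \<bullet> x"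
    using pos_op_decseq_limit[of X, OF X dec] by blast
  \<comment> \<open>Shifting the index exhibits \<open>F x\<close> as a limit of values of
    \<open>phi n V\<close>; this takes the place of exchanging the strong limit with the possibly
    infinite sum.\<close>
  have lim: "(\<lambda>k. phi n V (X k) x) \<longlonglongrightarrow> F x" for x
    using LIMSEQ_Suc[OF F(2)] by (simp add: XS)
  have bF: "bop F" and bX: "bop (X k)" for k using F(1) X pos_opD(1) by auto
  have "phi n V F x = F x" for x
  proof -
    \<comment> \<open>The defect \<open>y\<close> is killed by every \<open>cadj (V i)\<close>,
      while \<open>F x\<close> and \<open>phi n V F x\<close> are orthogonal to all such vectors; so
      \<open>y\<close> is orthogonal to itself.\<close>
    define y where "y = F x - phi n V F x"
    have y0: "cadj (V i) y = 0" if i: "i \<in> idx n" for i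
    proof -
      have "(\<lambda>k. X k (cadj (V i) x)) \<longlonglongrightarrow> cadj (V i) (F x)"
        using bop_tendsto[OF bop_cadj[OF bopV[OF i]] lim[of x]] by (simp add: cadj_phi[OF bX i])
      then have "cadj (V i) (F x) = F (cadj (V i) x)" using F(2) LIMSEQ_unique by blast
      then show ?thesis
        by (simp add: y_def bop_simps(3)[OF bop_cadj[OF bopV[OF i]]] cadj_phi[OF bF i])
    qed
    have "(\<lambda>k. phi n V (X k) x \<bullet> y) \<longlonglongrightarrow> F x \<bullet> y" by (intro tendsto_inner lim tendsto_const)
    then have "F x \<bullet> y = 0" by (simp add: phi_inner_wandering[OF bX y0] LIMSEQ_const_iff)
    moreover have "phi n V F x \<bullet> y = 0" by (rule phi_inner_wandering[OF bF y0])
    ultimately have "y \<bullet> y = 0" by (simp add: y_def inner_diff_left)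
    then show ?thesis by (simp add: y_def)
  qed
  then have "phi n V F = F" by (rule ext)
  moreover have "F x \<bullet> x \<le> D x \<bullet> x" for x using F(3)[of x 0] by (simp only: X0)
  ultimately show ?thesis using F(1,2) unfolding X_def by blast
qed

end

section \<open>Lifting to the dilation\<close>

locale row_dilation = row_isometry n V
  for n and V :: "nat \<Rightarrow> 'k::complex_hilbert \<Rightarrow> 'k" +
  fixes T :: "nat \<Rightarrow> 'h::complex_hilbert \<Rightarrow> 'h" and W :: "'h \<Rightarrow> 'k"
  assumes bopT: "i \<in> idx n \<Longrightarrow> bop (T i)"
    and bopW: "bop W" and normW: "norm (W h) = norm h"
    and cadj_V_W: "i \<in> idx n \<Longrightarrow> cadj (V i) (W h) = W (cadj (T i) h)"
    and dense: "closure (span {vword V \<alpha> (W h) | \<alpha> h. set \<alpha> \<subseteq> idx n}) = UNIV"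
begin

lemma cadj_W_W: "cadj W (W h) = h"
  by (rule cadj_isometry[OF bopW normW])

lemma bop_compress: "bop D \<Longrightarrow> bop (cadj W \<circ> D \<circ> W)"
  unfolding comp_def by (rule bop_compose[OF bop_cadj[OF bopW] bop_compose[OF _ bopW]])

lemma T_cadj_W:
  assumes i: "i \<in> idx n" shows "T i (cadj W y) = cadj W (V i y)"
proof -
  have "T i (cadj W y) \<bullet> h = cadj W (V i y) \<bullet> h" for h
    by (simp add: inner_cadj[OF bopT[OF i]] inner_cadj'[OF bopW] cadj_V_W[OF i, symmetric]
        inner_cadj[OF bopV[OF i]])
  then show ?thesis using vector_eq_rdot by blast
qed

text \<open>Termwise, \<open>cadj_V_W\<close> moves \<open>W\<close> past \<open>cadj (T i)\<close>
  and its adjoint relation moves \<open>cadj W\<close> past \<open>T i\<close>. Boundedness of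
  \<open>cadj W\<close> carries the convergent sum for \<open>V\<close> over to the one for
  \<open>T\<close>.\<close>

lemma phi_compress:
  assumes D: "bop D"
  shows "phi n T (cadj W \<circ> D \<circ> W) = cadj W \<circ> phi n V D \<circ> W"
proof
  fix h
  have "((\<lambda>i. cadj W (V i (D (cadj (V i) (W h))))) has_sum cadj W (phi n V D (W h))) (idx n)"
    by (rule has_sum_bounded_linear[OF bopD(1)[OF bop_cadj[OF bopW]] has_sum_phi[OF D]])
  then have "((\<lambda>i. T i ((cadj W \<circ> D \<circ> W) (cadj (T i) h))) has_sum cadj W (phi n V D (W h))) (idx n)"
    by (subst has_sum_cong[where g = "\<lambda>i. cadj W (V i (D (cadj (V i) (W h))))"])
      (simp_all add: T_cadj_W cadj_V_W)
  then show "phi n T (cadj W \<circ> D \<circ> W) h = (cadj W \<circ> phi n V D \<circ> W) h"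
    unfolding phi_def[of n T] by (simp add: infsumI)
qed

lemma phi_funpow_compress:
  "bop D \<Longrightarrow> (phi n T ^^ k) (cadj W \<circ> D \<circ> W) = cadj W \<circ> (phi n V ^^ k) D \<circ> W"
  by (induction k) (simp_all add: phi_compress bop_phi_funpow)

text \<open>\<open>W \<circ> C \<circ> cadj W\<close> is the trivial lift: \<open>C\<close> on the
  range of \<open>W\<close>, zero on its orthogonal complement. It starts the induction.\<close>

lemma compress_expand: "cadj W \<circ> (W \<circ> C \<circ> cadj W) \<circ> W = C"
  by (simp add: fun_eq_iff cadj_W_W)

lemma pos_op_expand:
  assumes C: "pos_op C" shows "pos_op (W \<circ> C \<circ> cadj W)"
  unfolding pos_op_iff
proof (intro conjI allI)
  show "bop (W \<circ> C \<circ> cadj W)"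
    unfolding comp_def by (rule bop_compose[OF bopW bop_compose[OF pos_opD(1)[OF C] bop_cadj[OF bopW]]])
  show "(W \<circ> C \<circ> cadj W) x \<bullet> y = x \<bullet> (W \<circ> C \<circ> cadj W) y" for x y
    by (simp add: inner_cadj[OF bopW] pos_opD(2)[OF C, of "cadj W x"] flip: inner_cadj'[OF bopW])
  show "0 \<le> (W \<circ> C \<circ> cadj W) x \<bullet> x" for x
    by (simp add: inner_cadj[OF bopW] pos_opD(3)[OF C])
qed

text \<open>Applying \<open>phi_compress\<close> to the trivial lift makes \<open>phi n T C\<close>
  a compression of a positive operator.\<close>

lemma pos_op_phi_T:
  assumes C: "pos_op C" shows "pos_op (phi n T C)"
proof -
  note p = pos_op_expand[OF C]
  have "phi n T C = cadj W \<circ> phi n V (W \<circ> C \<circ> cadj W) \<circ> W"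
    using phi_compress[OF pos_opD(1)[OF p]] unfolding compress_expand .
  then show ?thesis using pos_op_compress[OF pos_op_phi[OF p] bopW] by simp
qed

lemma inner_compress: "(cadj W \<circ> D \<circ> W) h \<bullet> k = D (W h) \<bullet> W k"
  by (simp add: inner_cadj'[OF bopW])

text \<open>Compression cannot increase the norm, and for positive \<open>D\<close> the form bound
  \<open>le\<close> gives the opposite inequality. The norm condition thus reduces to keeping the
  lift below \<open>onorm C\<close>.\<close>

lemma onorm_compress:
  assumes D: "pos_op D" and C: "C = cadj W \<circ> D \<circ> W"
    and le: "\<And>x. D x \<bullet> x \<le> onorm C * (norm x)\<^sup>2"
  shows "onorm C = onorm D"
proof (rule antisym)
  have bC: "bop C" unfolding C by (rule bop_compress[OF pos_opD(1)[OF D]])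
  show "onorm D \<le> onorm C"
    by (rule onorm_bound) (use onorm_pos_le[OF bopD(1)[OF bC]] pos_op_norm_le[OF D _ le] in auto)
  have "norm (C h) \<le> onorm D * norm h" for h
  proof -
    have "norm (C h) \<le> norm (D (W h))"
      unfolding C by (simp add: norm_cadj_isometry_le[OF bopW normW])
    also have "\<dots> \<le> onorm D * norm (W h)" by (rule onorm[OF bopD(1)[OF pos_opD(1)[OF D]]])
    finally show ?thesis by (simp add: normW)
  qed
  then show "onorm C \<le> onorm D"
    by (rule onorm_bound[OF onorm_pos_le[OF bopD(1)[OF pos_opD(1)[OF D]]]])
qed

section \<open>The filtration of the dilation space and the lift along it\<close>

text \<open>Cut out by conditions on adjoints and not generated by words, so that each
  \<open>cadj (V i)\<close> maps \<open>level (Suc m)\<close> into \<open>level m\<close> by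
  definition, as the use of \<open>phi_form_eq\<close> demands.\<close>

primrec level :: "nat \<Rightarrow> 'k set" where
  "level 0 = range W"
| "level (Suc m) = {x. \<forall>i\<in>idx n. cadj (V i) x \<in> level m}"

lemma subspace_level: "subspace (level m)"
proof (induction m)
  case 0
  show ?case using linear_subspace_image[OF bounded_linear.linear[OF bopD(1)[OF bopW]] subspace_UNIV] by simp
next
  case (Suc m)
  then show ?case unfolding subspace_def
    by (auto simp: bop_simps(2,4,5)[OF bop_cadj[OF bopV]])
qed

lemma iscale_level: "x \<in> level m \<Longrightarrow> iscale x \<in> level m"
  by (induction m arbitrary: x) (auto simp: bop_simps(1)[OF bop_cadj[OF bopV]] simp flip: bop_simps(1)[OF bopW])

text \<open>The base case is the invariance of the range of \<open>W\<close> under each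
  \<open>cadj (V i)\<close>.\<close>

lemma level_Suc: "level m \<subseteq> level (Suc m)"
  by (induction m) (auto simp: cadj_V_W)

lemma level_mono: "m \<le> l \<Longrightarrow> level m \<subseteq> level l"
  using lift_Suc_mono_le[of level m l] level_Suc by blast

lemma subspace_Union_level: "subspace (\<Union>m. level m)"
  unfolding subspace_def
proof (intro conjI ballI allI)
  show "0 \<in> (\<Union>m. level m)" using subspace_0[OF subspace_level] by blast
  show "x + y \<in> (\<Union>m. level m)" if xy: "x \<in> (\<Union>m. level m)" "y \<in> (\<Union>m. level m)" for x y
  proof -
    obtain a b where "x \<in> level a" "y \<in> level b" using xy by blast
    then have "x \<in> level (max a b)" "y \<in> level (max a b)"
      using level_mono[of a "max a b"] level_mono[of b "max a b"] by auto
    then show ?thesis using subspace_add[OF subspace_level] by blast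
  qed
  show "r *\<^sub>R x \<in> (\<Union>m. level m)" if "x \<in> (\<Union>m. level m)" for r x
    using that subspace_scale[OF subspace_level] by blast
qed

text \<open>\<open>cadj (V i)\<close> strips the first letter of a word if that letter is
  \<open>i\<close>, and yields 0 otherwise.\<close>

lemma vword_level: "set \<alpha> \<subseteq> idx n \<Longrightarrow> vword V \<alpha> (W h) \<in> level (length \<alpha>)"
  by (induction \<alpha>) (auto simp: cadj_V subspace_0[OF subspace_level])

lemma dense_level: "closure (\<Union>m. level m) = UNIV"
proof -
  have "span {vword V \<alpha> (W h) | \<alpha> h. set \<alpha> \<subseteq> idx n} \<subseteq> (\<Union>m. level m)"
    by (rule span_minimal[OF _ subspace_Union_level]) (use vword_level in blast)
  then show ?thesis using closure_mono dense by blast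
qed

lemma positive_lift:
  assumes C: "pos_op C" and sub: "\<And>h. phi n T C h \<bullet> h \<le> C h \<bullet> h"
  shows "\<exists>D. pos_op D \<and> (\<forall>x. phi n V D x \<bullet> x \<le> D x \<bullet> x) \<and> cadj W \<circ> D \<circ> W = C \<and>
    (\<forall>x. D x \<bullet> x \<le> onorm C * (norm x)\<^sup>2)"
proof -
  define c where "c = onorm C"
  have c: "0 \<le> c" unfolding c_def by (rule onorm_pos_le[OF bopD(1)[OF pos_opD(1)[OF C]]])
  \<comment> \<open>\<open>P m D\<close> asks for a lift below \<open>c\<close> that is subinvariant
    on \<open>level m\<close> only. In \<open>R\<close>, domination of \<open>phi n V D\<close>
    holds on the whole space, and it is what produces subinvariance one level up.\<close>
  define P where "P m D \<longleftrightarrow> pos_op D \<and> (\<forall>x. D x \<bullet> x \<le> c * (norm x)\<^sup>2) \<and>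
    (\<forall>x\<in>level m. phi n V D x \<bullet> x \<le> D x \<bullet> x) \<and> (\<forall>h k. D (W h) \<bullet> W k = C h \<bullet> k)" for m D
  define R where "R m D D' \<longleftrightarrow> (\<forall>x. phi n V D x \<bullet> x \<le> D' x \<bullet> x) \<and>
    (\<forall>x\<in>level m. \<forall>y\<in>level m. D' x \<bullet> y = D x \<bullet> y)" for m D D'
  have "\<exists>f. \<forall>m. P m (f m) \<and> R m (f m) (f (Suc m))"
  proof (rule dependent_nat_choice)
    let ?D = "W \<circ> C \<circ> cadj W"
    note pD = pos_op_expand[OF C]
    have "?D x \<bullet> x \<le> c * (norm x)\<^sup>2" for x
    proof -
      have "?D x \<bullet> x = C (cadj W x) \<bullet> cadj W x" by (simp add: inner_cadj[OF bopW])
      also have "\<dots> \<le> c * (norm (cadj W x))\<^sup>2"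
        unfolding c_def by (rule inner_le_onorm[OF pos_opD(1)[OF C]])
      also have "\<dots> \<le> c * (norm x)\<^sup>2"
        by (intro mult_left_mono power_mono norm_cadj_isometry_le[OF bopW normW] c) simp
      finally show ?thesis .
    qed
    moreover have DW: "?D (W h) \<bullet> W k = C h \<bullet> k" for h k
      by (simp add: inner_cadj[OF bopW] cadj_W_W)
    \<comment> \<open>On the range of \<open>W\<close>, subinvariance of the trivial lift is exactly
      the hypothesis \<open>sub\<close>, by \<open>phi_compress\<close>.\<close>
    moreover have "phi n V ?D (W h) \<bullet> W h \<le> ?D (W h) \<bullet> W h" for h
      using sub[of h] fun_cong[OF phi_compress[OF pos_opD(1)[OF pD]], of h]
      unfolding compress_expand DW by (simp add: inner_cadj'[OF bopW])
    ultimately have "P 0 ?D" using pD unfolding P_def by auto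
    then show "\<exists>D. P 0 D" by blast
  next
    fix D m assume PD: "P m D"
    then have D: "pos_op D" "\<And>x. D x \<bullet> x \<le> c * (norm x)\<^sup>2"
      "\<And>x. x \<in> level m \<Longrightarrow> phi n V D x \<bullet> x \<le> D x \<bullet> x" "\<And>h k. D (W h) \<bullet> W k = C h \<bullet> k"
      unfolding P_def by auto
    obtain D' where D': "pos_op D'" "\<And>x. phi n V D x \<bullet> x \<le> D' x \<bullet> x"
      "\<And>x. D' x \<bullet> x \<le> c * (norm x)\<^sup>2"
      "\<And>x y. x \<in> level m \<Longrightarrow> y \<in> level m \<Longrightarrow> D' x \<bullet> y = D x \<bullet> y"
      using pos_op_interpolation[OF subspace_level iscale_level pos_op_phi[OF D(1)] D(1)
          phi_form_bound[OF pos_opD(1)[OF D(1)] c D(2)] D(2) c D(3)] by blast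
    \<comment> \<open>For \<open>x\<close> in \<open>level (Suc m)\<close> the vectors
      \<open>cadj (V i) x\<close> lie in \<open>level m\<close>, where \<open>D'\<close> and
      \<open>D\<close> have the same form; so \<open>phi n V D'\<close> may be replaced by
      \<open>phi n V D\<close>.\<close>
    have "phi n V D' x \<bullet> x \<le> D' x \<bullet> x" if "x \<in> level (Suc m)" for x
      using D'(2)[of x] phi_form_eq[OF pos_opD(1)[OF D'(1)] pos_opD(1)[OF D(1)], of x x] D'(4) that
      by auto
    moreover have "W h \<in> level m" for h using level_mono[of 0 m] by auto
    ultimately have "P (Suc m) D' \<and> R m D D'"
      unfolding P_def R_def using D' D(4) by auto
    then show "\<exists>D'. P (Suc m) D' \<and> R m D D'" by blast
  qed
  then obtain f where Pf: "\<And>m. P m (f m)" and Rf: "\<And>m. R m (f m) (f (Suc m))" by blast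
  have f: "pos_op (f m)" "f m x \<bullet> x \<le> c * (norm x)\<^sup>2" "f m (W h) \<bullet> W k = C h \<bullet> k" for m x h k
    using Pf[of m] unfolding P_def by auto
  note bf = pos_opD(1)[OF f(1)]
  have f_stable: "f l x \<bullet> y = f m x \<bullet> y" if "m \<le> l" "x \<in> level m" "y \<in> level m" for l m x y
    using that(1)
  proof (induction l rule: dec_induct)
    case (step l)
    have "x \<in> level l" "y \<in> level l" using level_mono[OF step(1)] that by auto
    then show ?case using Rf[of l] step unfolding R_def by auto
  qed simp
  \<comment> \<open>For \<open>x\<close>, \<open>y\<close> in a common level the sequence is
    eventually constant, so \<open>lim\<close> is its value; \<open>Q\<close> is evaluated only at
    such pairs.\<close>
  define Q where "Q x y = lim (\<lambda>l. f l x \<bullet> y)" for x y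
  have Q: "Q x y = f m x \<bullet> y" if "x \<in> level m" "y \<in> level m" for m x y
    unfolding Q_def
    by (intro limI tendsto_eventually eventually_sequentiallyI[of m] f_stable that)
  define S where "S = (\<Union>m. level m)"
  have S: "subspace S" unfolding S_def by (rule subspace_Union_level)
  have common: "\<exists>m. x \<in> level m \<and> y \<in> level m \<and> z \<in> level m" if "x \<in> S" "y \<in> S" "z \<in> S" for x y z
  proof -
    obtain a b d where "x \<in> level a" "y \<in> level b" "z \<in> level d" using \<open>x \<in> S\<close> \<open>y \<in> S\<close> \<open>z \<in> S\<close> by (auto simp: S_def)
    then show ?thesis
      using level_mono[of a "a + b + d"] level_mono[of b "a + b + d"] level_mono[of d "a + b + d"] by auto
  qed
  \<comment> \<open>Form extension with \<open>J\<close> the identity and \<open>c\<close> as the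
    bound.\<close>
  have "\<exists>D. pos_op D \<and> (\<forall>x. D x \<bullet> x \<le> c * (norm x)\<^sup>2) \<and> (\<forall>x\<in>S. \<forall>y\<in>S. D x \<bullet> y = Q x y)"
  proof (rule pos_op_form_extension[OF S _ bop_id c])
    show "iscale x \<in> S" if "x \<in> S" for x using that iscale_level by (auto simp: S_def)
    show "Q (x + y) z = Q x z + Q y z" if xyz: "x \<in> S" "y \<in> S" "z \<in> S" for x y z
    proof -
      obtain m where m: "x \<in> level m" "y \<in> level m" "z \<in> level m" using common[OF xyz] by blast
      then have "x + y \<in> level m" by (intro subspace_add[OF subspace_level])
      then show ?thesis using m by (simp add: Q bop_simps(2)[OF bf] inner_add_left)
    qed
    show "Q (r *\<^sub>R x) z = r * Q x z" if xz: "x \<in> S" "z \<in> S" for r x z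
    proof -
      obtain m where m: "x \<in> level m" "z \<in> level m" using common[OF xz xz(2)] by blast
      then have "r *\<^sub>R x \<in> level m" by (intro subspace_scale[OF subspace_level])
      then show ?thesis using m by (simp add: Q bop_simps(4)[OF bf])
    qed
    show "Q x z = Q z x" if xz: "x \<in> S" "z \<in> S" for x z
    proof -
      obtain m where m: "x \<in> level m" "z \<in> level m" using common[OF xz xz(2)] by blast
      then show ?thesis using pos_opD(2)[OF f(1), of m x z] by (simp add: Q inner_commute)
    qed
    show "Q (iscale x) (iscale z) = Q x z" if xz: "x \<in> S" "z \<in> S" for x z
    proof -
      obtain m where m: "x \<in> level m" "z \<in> level m" using common[OF xz xz(2)] by blast
      then have "iscale x \<in> level m" "iscale z \<in> level m" by (auto intro: iscale_level)
      then show ?thesis using m by (simp add: Q bop_simps(1)[OF bf] inner_iscale)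
    qed
    show "0 \<le> Q x x" and "Q x x \<le> c * (norm x)\<^sup>2" if x: "x \<in> S" for x
      using x by (auto simp: S_def Q pos_opD(3)[OF f(1)] f(2))
  qed
  then obtain D where D: "pos_op D" "\<And>x. D x \<bullet> x \<le> c * (norm x)\<^sup>2"
    "\<And>x y. x \<in> S \<Longrightarrow> y \<in> S \<Longrightarrow> D x \<bullet> y = Q x y" by blast
  have Df: "D x \<bullet> y = f m x \<bullet> y" if "x \<in> level m" "y \<in> level m" for x y m
  proof -
    have "x \<in> S" "y \<in> S" using that by (auto simp: S_def)
    then show ?thesis using Q[OF that] D(3) by simp
  qed
  note bD = pos_opD(1)[OF D(1)]
  have "phi n V D x \<bullet> x \<le> D x \<bullet> x" for x
  proof -
    have on_S: "phi n V D x \<bullet> x \<le> D x \<bullet> x" if "x \<in> S" for x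
    proof -
      obtain m where m: "x \<in> level m" using \<open>x \<in> S\<close> by (auto simp: S_def)
      \<comment> \<open>The detour through \<open>level (Suc m)\<close> puts
        \<open>cadj (V i) x\<close> into \<open>level m\<close>, where \<open>D\<close> agrees with
        \<open>f m\<close>; the bound from \<open>R\<close> then lands in \<open>f (Suc m)\<close>,
        which agrees with \<open>D\<close> at \<open>x\<close>.\<close>
      then have m': "x \<in> level (Suc m)" using level_Suc by blast
      have "phi n V D x \<bullet> x = phi n V (f m) x \<bullet> x"
        using m' by (intro phi_form_eq bD bf Df) auto
      also have "\<dots> \<le> f (Suc m) x \<bullet> x" using Rf[of m] unfolding R_def by blast
      also have "\<dots> = D x \<bullet> x" by (rule Df[OF m' m', symmetric])
      finally show ?thesis .
    qed
    have cont: "continuous_on UNIV (phi n V D)" "continuous_on UNIV D"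
      using linear_continuous_on[OF bopD(1)[OF bop_phi[OF bD]]] linear_continuous_on[OF bopD(1)[OF bD]] by auto
    have "closed {x. phi n V D x \<bullet> x \<le> D x \<bullet> x}"
      by (intro closed_Collect_le continuous_intros cont)
    then have "closure S \<subseteq> {x. phi n V D x \<bullet> x \<le> D x \<bullet> x}"
      using on_S by (intro closure_minimal) auto
    then show ?thesis using dense_level unfolding S_def by blast
  qed
  moreover have "cadj W \<circ> D \<circ> W = C"
  proof
    fix h
    have "(cadj W \<circ> D \<circ> W) h \<bullet> k = C h \<bullet> k" for k
      unfolding inner_compress using Df[of "W h" 0 "W k"] f(3) by simp
    then show "(cadj W \<circ> D \<circ> W) h = C h" using vector_eq_rdot by blast
  qed
  ultimately show ?thesis using D(1,2) unfolding c_def by blast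
qed

section \<open>Subinvariant, invariant and pure solutions\<close>

lemma op_le_phi_V_iff: "pos_op D \<Longrightarrow> op_le (phi n V D) D \<longleftrightarrow> (\<forall>x. phi n V D x \<bullet> x \<le> D x \<bullet> x)"
  by (rule op_le_iff[OF pos_op_phi])

lemma op_le_phi_T_iff: "pos_op C \<Longrightarrow> op_le (phi n T C) C \<longleftrightarrow> (\<forall>x. phi n T C x \<bullet> x \<le> C x \<bullet> x)"
  by (rule op_le_iff[OF pos_op_phi_T])

lemma compress_subinvariant:
  assumes D: "pos_op D" and le: "op_le (phi n V D) D"
  shows "op_le (phi n T (cadj W \<circ> D \<circ> W)) (cadj W \<circ> D \<circ> W)"
proof -
  have "phi n T (cadj W \<circ> D \<circ> W) h \<bullet> h \<le> (cadj W \<circ> D \<circ> W) h \<bullet> h" for h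
    unfolding phi_compress[OF pos_opD(1)[OF D]] inner_compress
    using le unfolding op_le_phi_V_iff[OF D] by blast
  then show ?thesis unfolding op_le_phi_T_iff[OF pos_op_compress[OF D bopW]] by blast
qed

lemma subinvariant_lift:
  assumes C: "pos_op C" and le: "op_le (phi n T C) C"
  shows "\<exists>D. pos_op D \<and> op_le (phi n V D) D \<and> C = cadj W \<circ> D \<circ> W \<and> onorm C = onorm D"
proof -
  obtain D where D: "pos_op D" "\<And>x. phi n V D x \<bullet> x \<le> D x \<bullet> x" "C = cadj W \<circ> D \<circ> W"
    "\<And>x. D x \<bullet> x \<le> onorm C * (norm x)\<^sup>2"
    using positive_lift[OF C] le unfolding op_le_phi_T_iff[OF C] by metis
  show ?thesis
    using D(1,2,3) onorm_compress[OF D(1,3,4)] op_le_phi_V_iff[OF D(1)] by blast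
qed

text \<open>Shared by the invariant and the pure case, which differ only in the value of the limit
  of the iterates of \<open>phi n T\<close> on \<open>C\<close>.\<close>

lemma lift_with_limit:
  assumes C: "pos_op C" and le: "op_le (phi n T C) C"
  obtains D F where "pos_op D" "\<And>x. phi n V D x \<bullet> x \<le> D x \<bullet> x" "C = cadj W \<circ> D \<circ> W"
    "\<And>x. D x \<bullet> x \<le> onorm C * (norm x)\<^sup>2" "pos_op F" "\<And>x. F x \<bullet> x \<le> D x \<bullet> x"
    "phi n V F = F" "\<And>x. (\<lambda>k. (phi n V ^^ k) D x) \<longlonglongrightarrow> F x"
    "\<And>h. (\<lambda>k. (phi n T ^^ k) C h) \<longlonglongrightarrow> (cadj W \<circ> F \<circ> W) h"
proof -
  obtain D where D: "pos_op D" "\<And>x. phi n V D x \<bullet> x \<le> D x \<bullet> x" "C = cadj W \<circ> D \<circ> W"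
    "\<And>x. D x \<bullet> x \<le> onorm C * (norm x)\<^sup>2"
    using positive_lift[OF C] le unfolding op_le_phi_T_iff[OF C] by metis
  obtain F where F: "pos_op F" "\<And>x. (\<lambda>k. (phi n V ^^ k) D x) \<longlonglongrightarrow> F x"
    "\<And>x. F x \<bullet> x \<le> D x \<bullet> x" "phi n V F = F"
    using phi_funpow_limit[OF D(1,2)] by blast
  have "(\<lambda>k. (phi n T ^^ k) C h) \<longlonglongrightarrow> (cadj W \<circ> F \<circ> W) h" for h
    unfolding D(3) phi_funpow_compress[OF pos_opD(1)[OF D(1)]] comp_apply
    by (rule bop_tendsto[OF bop_cadj[OF bopW] F(2)])
  then show ?thesis using that D F by blast
qed

lemma invariant_lift:
  assumes C: "pos_op C" and eq: "phi n T C = C"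
  shows "\<exists>D. pos_op D \<and> phi n V D = D \<and> C = cadj W \<circ> D \<circ> W \<and> onorm C = onorm D"
proof -
  have "op_le (phi n T C) C" unfolding op_le_phi_T_iff[OF C] by (simp add: eq)
  then obtain D F where DF: "\<And>x. D x \<bullet> x \<le> onorm C * (norm x)\<^sup>2" "pos_op F" "\<And>x. F x \<bullet> x \<le> D x \<bullet> x"
    "phi n V F = F" "\<And>h. (\<lambda>k. (phi n T ^^ k) C h) \<longlonglongrightarrow> (cadj W \<circ> F \<circ> W) h"
    using lift_with_limit[OF C] by metis
  have "(phi n T ^^ k) C = C" for k by (induction k) (simp_all add: eq)
  then have CF: "C = cadj W \<circ> F \<circ> W" using DF(5) by (auto simp: fun_eq_iff LIMSEQ_const_iff)
  \<comment> \<open>\<open>F\<close> inherits the ceiling \<open>onorm C\<close> from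
    \<open>D\<close>, above which it never rises.\<close>
  have "onorm C = onorm F"
    by (rule onorm_compress[OF DF(2) CF]) (rule order_trans[OF DF(3,1)])
  then show ?thesis using DF(2,4) CF by blast
qed

lemma pure_lift:
  assumes pure: "pure_solution (phi n T) C"
  shows "\<exists>D. pure_solution (phi n V) D \<and> C = cadj W \<circ> D \<circ> W \<and> onorm C = onorm D"
proof -
  have C: "pos_op C" "op_le (phi n T C) C" and C0: "\<And>h. (\<lambda>k. (phi n T ^^ k) C h) \<longlonglongrightarrow> 0"
    using pure unfolding pure_solution_def by auto
  obtain D F where D: "pos_op D" "\<And>x. phi n V D x \<bullet> x \<le> D x \<bullet> x" "C = cadj W \<circ> D \<circ> W"
    "\<And>x. D x \<bullet> x \<le> onorm C * (norm x)\<^sup>2"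
    and F: "pos_op F" "\<And>x. F x \<bullet> x \<le> D x \<bullet> x" "phi n V F = F"
    "\<And>x. (\<lambda>k. (phi n V ^^ k) D x) \<longlonglongrightarrow> F x"
    "\<And>h. (\<lambda>k. (phi n T ^^ k) C h) \<longlonglongrightarrow> (cadj W \<circ> F \<circ> W) h"
    using lift_with_limit[OF C] by metis
  note bD = pos_opD(1)[OF D(1)] and bF = pos_opD(1)[OF F(1)]
  define G where "G x = D x - F x" for x
  have G: "pos_op G" unfolding G_def by (rule pos_op_diff[OF D(1) F(1) F(2)])
  \<comment> \<open>Because \<open>phi n V\<close> fixes \<open>F\<close>, each iterate on
    \<open>G\<close> is the iterate on \<open>D\<close> minus the same \<open>F\<close>, and so
    tends to 0.\<close>
  have powG: "(phi n V ^^ k) G = (\<lambda>x. (phi n V ^^ k) D x - F x)" for k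
  proof (induction k)
    case (Suc k)
    then show ?case using phi_diff[OF bop_phi_funpow[OF bD] bF, of k] by (simp add: F(3))
  qed (simp add: G_def fun_eq_iff)
  have phiG: "phi n V G x = phi n V D x - F x" for x using powG[of 1] by simp
  have WFW: "(cadj W \<circ> F \<circ> W) h = 0" for h using LIMSEQ_unique[OF F(5) C0] .
  have "pure_solution (phi n V) G"
    unfolding pure_solution_def
  proof (intro conjI allI G)
    show "op_le (phi n V G) G"
      unfolding op_le_phi_V_iff[OF G] phiG G_def using D(2) by (simp add: inner_diff_left)
    show "(\<lambda>k. (phi n V ^^ k) G x) \<longlonglongrightarrow> 0" for x
      unfolding powG using LIM_zero[OF F(4)] .
  qed
  moreover have CG: "C = cadj W \<circ> G \<circ> W"
    using WFW by (simp add: D(3) G_def fun_eq_iff bop_simps(3)[OF bop_cadj[OF bopW]])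
  moreover have "onorm C = onorm G"
  proof (rule onorm_compress[OF G CG])
    show "G x \<bullet> x \<le> onorm C * (norm x)\<^sup>2" for x
      using D(4)[of x] pos_opD(3)[OF F(1), of x] by (simp add: G_def inner_diff_left)
  qed
  ultimately show ?thesis by blast
qed

lemma compress_pure:
  assumes pure: "pure_solution (phi n V) D"
  shows "pure_solution (phi n T) (cadj W \<circ> D \<circ> W)"
proof -
  have D: "pos_op D" "op_le (phi n V D) D" and D0: "\<And>h. (\<lambda>k. (phi n V ^^ k) D h) \<longlonglongrightarrow> 0"
    using pure unfolding pure_solution_def by auto
  have "(\<lambda>k. (phi n T ^^ k) (cadj W \<circ> D \<circ> W) h) \<longlonglongrightarrow> 0" for h
    using bop_tendsto[OF bop_cadj[OF bopW] D0[of "W h"]]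
    unfolding phi_funpow_compress[OF pos_opD(1)[OF D(1)]] comp_apply bop_simps(5)[OF bop_cadj[OF bopW]] .
  then show ?thesis
    unfolding pure_solution_def using pos_op_compress[OF D(1) bopW] compress_subinvariant[OF D] by blast
qed

end

theorem theorem3p5:
  fixes n :: enat
    and T :: "nat \<Rightarrow> 'h::complex_hilbert \<Rightarrow> 'h"
    and W :: "'h \<Rightarrow> 'k::complex_hilbert"
    and V :: "nat \<Rightarrow> 'k \<Rightarrow> 'k"
  assumes n_pos: "1 \<le> n"
    and T_bop: "\<forall>i\<in>idx n. bop (T i)"
    and phiT_conv: "\<forall>X h. bop X \<longrightarrow> (\<lambda>i. T i (X (cadj (T i) h))) summable_on idx n"
    and phiT_contr: "op_le (phi n T id) id"
    and dil: "min_iso_dilation n T W V"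
  shows "(\<forall>C. pos_op C \<longrightarrow>
            (op_le (phi n T C) C \<longleftrightarrow>
              (\<exists>D. pos_op D \<and> op_le (phi n V D) D \<and>
                   C = cadj W \<circ> D \<circ> W \<and> onorm C = onorm D)))
       \<and> (\<forall>C. pos_op C \<longrightarrow>
            (phi n T C = C \<longleftrightarrow>
              (\<exists>D. pos_op D \<and> phi n V D = D \<and>
                   C = cadj W \<circ> D \<circ> W \<and> onorm C = onorm D)))
       \<and> (\<forall>C. pure_solution (phi n T) C \<longleftrightarrow>
              (\<exists>D. pure_solution (phi n V) D \<and>
                   C = cadj W \<circ> D \<circ> W \<and> onorm C = onorm D))"
proof -
  interpret row_dilation n V T W
  proof
    show "bop (V i)" if "i \<in> idx n" for i using dil that unfolding min_iso_dilation_def by blast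
    show "norm (V i x) = norm x" if "i \<in> idx n" for i x
      using dil that unfolding min_iso_dilation_def by blast
    show "V i x \<bullet> V j y = 0" if "i \<in> idx n" "j \<in> idx n" "i \<noteq> j" for i j x y
    proof -
      have "cinner (V i x) (V j y) = 0" using dil that unfolding min_iso_dilation_def by blast
      then show ?thesis by (simp add: cinner_def complex_eq_iff)
    qed
    show "bop (T i)" if "i \<in> idx n" for i using T_bop that by blast
    show "bop W" using dil unfolding min_iso_dilation_def by blast
    show "norm (W h) = norm h" for h using dil unfolding min_iso_dilation_def by blast
    show "cadj (V i) (W h) = W (cadj (T i) h)" if "i \<in> idx n" for i h
      using dil that unfolding min_iso_dilation_def by blast
    show "closure (span {vword V \<alpha> (W h) | \<alpha> h. set \<alpha> \<subseteq> idx n}) = UNIV"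
      using dil unfolding min_iso_dilation_def by blast
  qed
  show ?thesis
  proof (intro conjI allI impI)
    fix C :: "'h \<Rightarrow> 'h" assume C: "pos_op C"
    show "op_le (phi n T C) C \<longleftrightarrow> (\<exists>D. pos_op D \<and> op_le (phi n V D) D \<and>
        C = cadj W \<circ> D \<circ> W \<and> onorm C = onorm D)"
      using subinvariant_lift[OF C] compress_subinvariant by blast
    \<comment> \<open>Backwards, \<open>phi_compress\<close> turns \<open>phi n V D = D\<close> into
      invariance of the compression.\<close>
    show "phi n T C = C \<longleftrightarrow> (\<exists>D. pos_op D \<and> phi n V D = D \<and>
        C = cadj W \<circ> D \<circ> W \<and> onorm C = onorm D)"
      using invariant_lift[OF C] phi_compress pos_opD(1) by metis
  next
    fix C :: "'h \<Rightarrow> 'h"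
    show "pure_solution (phi n T) C \<longleftrightarrow> (\<exists>D. pure_solution (phi n V) D \<and>
        C = cadj W \<circ> D \<circ> W \<and> onorm C = onorm D)"
      using pure_lift compress_pure by blast
  qed
qed

end
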